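(* Let $\Phi$ be a Poisson point process on $\mathbb X$ with finite intensity measure $M(\mathrm dx)=m(x)\,\ell(\mathrm dx)$. Let $\Phi_C$ be the conditional Poisson point process associated to $\Phi$ with intensity measure $M$ and condition $C$, where $C$ is a measurable set of configurations, $C\in\mathcal N_{\mathbb X}$. Then $$\Delta_{TV}^*(\Phi_C,\Phi)\le\int_{\mathbb X}m(x)\,\mathbb P(\Phi_C\cup\{x\}\notin C)\,\ell(\mathrm dx).$$
   Context: $\mathbb X$ is a locally compact metric space with its Borel $\sigma$-algebra, and $\ell$ is a Radon measure on $\mathbb X$ (not necessarily diffuse). $N_{\mathbb X}$ is the set of configurations, i.e. nonnegative-integer-valued measures on $\mathbb X$ finite on relatively compact Borel sets (treated as multisets of points), and $\mathcal N_{\mathbb X}$ is the smallest $\sigma$-algebra on $N_{\mathbb X}$ making $\phi\mapsto\phi(A)$ measurable for every relatively compact Borel $A$; $\phi\cup\{x\}$ denotes $\phi+\delta_x$. A point process is a random configuration. Given a sequence $(\Phi^{(n)})_{n\ge1}$ of independent copies of $\Phi$, the conditional Poisson point process $\Phi_C$ is defined by $\Phi_C=\Phi^{(n)}$ if $\Phi^{(n)}\in C$ and $\Phi^{(i)}\notin C$ for all $i\in\{1,\dots,n-1\}$; that is, it is the first term of the sequence lying in $C$. For measures $\nu_1,\nu_2$ on $\mathbb X$, $\Delta_{TV}(\nu_1,\nu_2)=\sup|\nu_1(A)-\nu_2(A)|$, the supremum being over Borel $A$ with $\nu_1(A),\nu_2(A)<\infty$. For point processes $\Phi_1,\Phi_2$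 with laws $\mathbb P_1,\mathbb P_2$, $\Delta_{TV}^*(\Phi_1,\Phi_2)=\inf_{\mathbf C}\int\Delta_{TV}(\omega_1,\omega_2)\,\mathbf C(\mathrm d(\omega_1,\omega_2))$, the infimum being over all couplings $\mathbf C$ of $\mathbb P_1$ and $\mathbb P_2$.
   Formalization: Proved with P(Φ∈C)>0 and C almost hereditary: for M-almost every x, almost surely Φ∪{x}∈C implies Φ∈C. For arbitrary measurable C the bound is false: if C is the set of nonempty configurations and M≠0, the right side is 0 but the laws of Φ_C and Φ differ. *)

theory Defs
  imports "HOL-Probability.Probability"
begin

definition relatively_compact :: "'a::topological_space set \<Rightarrow> bool" where
  "relatively_compact A \<longleftrightarrow> compact (closure A)"

(* Finiteness on compact sets is local finiteness, as the space is locally compact. *)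
definition radon_measure :: "'a::metric_space measure \<Rightarrow> bool" where
  "radon_measure M \<longleftrightarrow> sets M = sets borel \<and>
     (\<forall>K. compact K \<longrightarrow> emeasure M K < \<infinity>) \<and>
     (\<forall>A \<in> sets borel. emeasure M A = (SUP K \<in> {K. compact K \<and> K \<subseteq> A}. emeasure M K))"

definition configurations :: "'a::metric_space measure set" where
  "configurations = {\<phi>. sets \<phi> = sets borel \<and>
     (\<forall>A \<in> sets borel. emeasure \<phi> A = \<infinity> \<or> (\<exists>k::nat. emeasure \<phi> A = of_nat k)) \<and>
     (\<forall>A \<in> sets borel. relatively_compact A \<longrightarrow> emeasure \<phi> A < \<infinity>)}"

definition config_space :: "'a::metric_space measure measure" where
  "config_space = sigma configurations
     {{\<phi> \<in> configurations. emeasure \<phi> A \<in> B} | A B.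
        A \<in> sets borel \<and> relatively_compact A \<and> B \<in> sets borel}"

definition add_point :: "'a::metric_space measure \<Rightarrow> 'a \<Rightarrow> 'a measure" where
  "add_point \<phi> x =
     measure_of UNIV (sets borel) (\<lambda>A. emeasure \<phi> A + emeasure (return borel x) A)"

lemma emeasure_add_point:
  assumes \<phi>: "\<phi> \<in> configurations" and A: "A \<in> sets borel"
  shows "emeasure (add_point \<phi> x) A = emeasure \<phi> A + indicator A x"
proof -
  have s: "sets \<phi> = sets borel"
    using \<phi> by (simp add: configurations_def)
  have "emeasure (add_point \<phi> x) A = emeasure \<phi> A + emeasure (return borel x) A"
    unfolding add_point_def
  proof (rule emeasure_measure_of_sigma)
    show "sigma_algebra UNIV (sets (borel :: 'a measure))"
      using sets.sigma_algebra_axioms[of "borel :: 'a measure"] by simp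
    show "positive (sets borel) (\<lambda>A. emeasure \<phi> A + emeasure (return borel x) A)"
      by (simp add: positive_def)
    show "countably_additive (sets borel) (\<lambda>A. emeasure \<phi> A + emeasure (return borel x) A)"
    proof (rule countably_additiveI)
      fix F :: "nat \<Rightarrow> 'a set"
      assume F: "range F \<subseteq> sets borel" "disjoint_family F"
      have "(\<Sum>i. emeasure \<phi> (F i)) = emeasure \<phi> (\<Union>i. F i)"
        using F s by (intro suminf_emeasure) auto
      moreover have "(\<Sum>i. emeasure (return borel x) (F i)) = emeasure (return borel x) (\<Union>i. F i)"
        using F by (intro suminf_emeasure) auto
      ultimately show "(\<Sum>i. emeasure \<phi> (F i) + emeasure (return borel x) (F i))
          = emeasure \<phi> (\<Union>i. F i) + emeasure (return borel x) (\<Union>i. F i)"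
        by (subst suminf_add[symmetric]) auto
    qed
  qed (use A in auto)
  then show ?thesis
    using A by simp
qed

definition point_process :: "'w measure \<Rightarrow> ('w \<Rightarrow> 'a::metric_space measure) \<Rightarrow> bool" where
  "point_process \<Omega> \<Phi> \<longleftrightarrow> prob_space \<Omega> \<and> \<Phi> \<in> measurable \<Omega> config_space"

abbreviation law :: "'w measure \<Rightarrow> ('w \<Rightarrow> 'a::metric_space measure) \<Rightarrow> 'a measure measure" where
  "law \<Omega> \<Phi> \<equiv> distr \<Omega> config_space \<Phi>"

definition poisson_process ::
  "'w measure \<Rightarrow> 'a::metric_space measure \<Rightarrow> ('w \<Rightarrow> 'a measure) \<Rightarrow> bool" where
  "poisson_process \<Omega> M \<Phi> \<longleftrightarrow> point_process \<Omega> \<Phi> \<and>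
     (\<forall>A \<in> sets borel. relatively_compact A \<longrightarrow>
        (\<forall>k::nat. measure \<Omega> {\<omega> \<in> space \<Omega>. emeasure (\<Phi> \<omega>) A = of_nat k}
           = measure M A ^ k / fact k * exp (- measure M A))) \<and>
     (\<forall>(A :: nat \<Rightarrow> 'a set) I. finite I \<longrightarrow> disjoint_family_on A I \<longrightarrow>
        (\<forall>i\<in>I. A i \<in> sets borel \<and> relatively_compact (A i)) \<longrightarrow>
        prob_space.indep_vars \<Omega> (\<lambda>_. borel) (\<lambda>i \<omega>. emeasure (\<Phi> \<omega>) (A i)) I)"

definition independent_copies ::
  "'v measure \<Rightarrow> (nat \<Rightarrow> 'v \<Rightarrow> 'a::metric_space measure) \<Rightarrow> 'a measure measure \<Rightarrow> bool" where
  "independent_copies \<Omega> \<Psi> P \<longleftrightarrow>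
     (\<forall>n. point_process \<Omega> (\<Psi> n) \<and> law \<Omega> (\<Psi> n) = P) \<and>
     prob_space.indep_vars \<Omega> (\<lambda>_. config_space) \<Psi> UNIV"

(* Indices start at 0.  The value in the else-branch is irrelevant: that branch is a null event
   as soon as C has positive probability. *)
definition conditional_process ::
  "'a::metric_space measure set \<Rightarrow> (nat \<Rightarrow> 'v \<Rightarrow> 'a measure) \<Rightarrow> 'v \<Rightarrow> 'a measure" where
  "conditional_process C \<Psi> \<omega> =
     (if \<exists>n. \<Psi> n \<omega> \<in> C then \<Psi> (LEAST n. \<Psi> n \<omega> \<in> C) \<omega> else null_measure borel)"

(* Up to null events, deleting a point of a configuration in C leaves a configuration in C;
   by the Mecke formula the exceptional pairs may be described by adding a point to the Poisson
   process.  This holds for every C stable under deletion of points, and it is what gives the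
   conditional process the Papangelou intensity m(x) 1{phi + delta_x in C}.
   Without it the bound fails: if C is the set of nonempty configurations, then adding a point
   never leads out of C, but conditioning on C changes the law. *)
definition almost_hereditary ::
  "'w measure \<Rightarrow> 'a::metric_space measure \<Rightarrow> ('w \<Rightarrow> 'a measure) \<Rightarrow> 'a measure set \<Rightarrow> bool" where
  "almost_hereditary \<Omega> M \<Phi> C \<longleftrightarrow>
     (AE x in M. AE \<omega> in \<Omega>. add_point (\<Phi> \<omega>) x \<in> C \<longrightarrow> \<Phi> \<omega> \<in> C)"

definition tv_dist :: "'a::metric_space measure \<Rightarrow> 'a measure \<Rightarrow> ennreal" where
  "tv_dist \<nu>\<^sub>1 \<nu>\<^sub>2 =
     (SUP A \<in> {A \<in> sets borel. emeasure \<nu>\<^sub>1 A < \<infinity> \<and> emeasure \<nu>\<^sub>2 A < \<infinity>}.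
        ennreal \<bar>measure \<nu>\<^sub>1 A - measure \<nu>\<^sub>2 A\<bar>)"

definition couplings ::
  "'a::metric_space measure measure \<Rightarrow> 'a measure measure \<Rightarrow> ('a measure \<times> 'a measure) measure set"
  where
  "couplings P\<^sub>1 P\<^sub>2 = {\<Gamma>. sets \<Gamma> = sets (config_space \<Otimes>\<^sub>M config_space) \<and>
     distr \<Gamma> config_space fst = P\<^sub>1 \<and> distr \<Gamma> config_space snd = P\<^sub>2}"

(* On a second countable space tv_dist is jointly measurable on configurations.  In general
   nn_integral is the lower integral. *)
definition tv_star :: "'a::metric_space measure measure \<Rightarrow> 'a measure measure \<Rightarrow> ennreal" where
  "tv_star P\<^sub>1 P\<^sub>2 = (INF \<Gamma> \<in> couplings P\<^sub>1 P\<^sub>2. \<integral>\<^sup>+ (\<omega>\<^sub>1, \<omega>\<^sub>2). tv_dist \<omega>\<^sub>1 \<omega>\<^sub>2 \<partial>\<Gamma>)"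

end

theory Submission
  imports Defs
begin

text \<open>
  Write \<open>L\<close> for the total mass of \<open>M\<close> and cut the Poisson process into \<open>k\<close> independent
  slots, each a Poisson number of mean \<open>L / k\<close> of independent points.  Let \<open>Y\<close> be the vector of
  slots conditioned on its superposition lying in \<open>C\<close>, and \<open>\<xi>\<close> an independent unconditioned
  vector.  Sweep once through the slots, replacing \<open>Y i\<close> by \<open>\<xi> i\<close> whenever the result stays in
  \<open>C\<close>.  Each such Metropolis step preserves the conditioned law, so the swept vector and \<open>\<xi>\<close>
  yield a coupling of the two processes, and they differ only in the slots where the replacement
  was rejected.

  At step \<open>i\<close>, let \<open>a\<close> and \<open>b\<close> be the numbers of points of the old and of the new slot.  The case
  \<open>a = 0\<close>, \<open>b = 1\<close> contributes at most \<open>1 / k\<close> times the right-hand side; if \<open>a = 1\<close>, \<open>b = 0\<close>, a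
  point is deleted, which is almost surely accepted as \<open>C\<close> is almost hereditary; and if
  \<open>a + b \<ge> 2\<close> the cost \<open>a + b\<close> is at most \<open>(a + b) * (a + b - 1)\<close>, whose mean is of order
  \<open>1 / k\<^sup>2\<close>.  Summing over the \<open>k\<close> slots and letting \<open>k\<close> tend to infinity gives the bound.
\<close>

subsection \<open>The space of configurations\<close>

text \<open>Cutting into slots turns the addition or deletion of a point into the resampling of one
  coordinate of a product measure, so reversibility is just exchangeability of the old and the new
  coordinate. The same exchange turns a rejected deletion into an addition to the unconditioned
  process, the form in which \<open>almost_hereditary\<close> is stated, so no Mecke formula has to
  be proved. One sweep suffices because slot \<open>j\<close> is touched at step \<open>j\<close>
  only, and \<open>\<xi> j\<close> is independent of the state met there, which still has the
  conditioned law; the mean cost of each step is thus that of one stationary step. Passing from the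
  conditioned to the unconditioned law costs a factor 1 / P(C), the same for all \<open>k\<close>,
  and is done only for terms that vanish or are of order 1 / k^2.\<close>

lemma config_generator_subset:
  "{{\<phi> \<in> configurations. emeasure \<phi> A \<in> B} | A B.
      A \<in> sets borel \<and> relatively_compact A \<and> B \<in> sets borel} \<subseteq> Pow configurations"
  by auto

lemma space_config_space: "space config_space = configurations"
  unfolding config_space_def by (rule space_measure_of[OF config_generator_subset])

lemma sets_config_space:
  "sets (config_space :: 'a::metric_space measure measure) = sigma_sets configurations
    {{\<phi> \<in> configurations. emeasure \<phi> A \<in> B} | A B.
      A \<in> sets borel \<and> relatively_compact A \<and> B \<in> sets borel}"
  unfolding config_space_def by (rule sets_measure_of[OF config_generator_subset])

lemma measurable_emeasure_config:
  assumes "A \<in> sets borel" "relatively_compact A"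
  shows "(\<lambda>\<phi>. emeasure \<phi> A) \<in> borel_measurable config_space"
proof (rule measurableI)
  fix B :: "ennreal set" assume B: "B \<in> sets borel"
  have "{\<phi> \<in> configurations. emeasure \<phi> A \<in> B} \<in> sets config_space"
    unfolding sets_config_space using assms B by (intro sigma_sets.Basic) auto
  moreover have "(\<lambda>\<phi>. emeasure \<phi> A) -` B \<inter> space config_space =
      {\<phi> \<in> configurations. emeasure \<phi> A \<in> B}"
    by (auto simp: space_config_space)
  ultimately show "(\<lambda>\<phi>. emeasure \<phi> A) -` B \<inter> space config_space \<in> sets config_space"
    by simp
qed simp

lemma measurable_config_spaceI:
  assumes "\<And>\<omega>. \<omega> \<in> space N \<Longrightarrow> f \<omega> \<in> configurations"
    and "\<And>A. A \<in> sets borel \<Longrightarrow> relatively_compact A \<Longrightarrow> (\<lambda>\<omega>. emeasure (f \<omega>) A) \<in> borel_measurable N"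
  shows "f \<in> measurable N config_space"
  unfolding config_space_def
proof (rule measurable_measure_of[OF config_generator_subset])
  show "f \<in> space N \<rightarrow> configurations" using assms(1) by auto
  fix y :: "'b measure set"
  assume "y \<in> {{\<phi> \<in> configurations. emeasure \<phi> A \<in> B} | A B.
      A \<in> sets borel \<and> relatively_compact A \<and> B \<in> sets borel}"
  then obtain A B where y: "y = {\<phi> \<in> configurations. emeasure \<phi> A \<in> B}"
    and A: "A \<in> sets borel" "relatively_compact A" and B: "B \<in> sets borel"
    by blast
  have "f -` y \<inter> space N = (\<lambda>\<omega>. emeasure (f \<omega>) A) -` B \<inter> space N"
    using assms(1) by (auto simp: y)
  then show "f -` y \<inter> space N \<in> sets N"
    using measurable_sets[OF assms(2)[OF A] B] by simp
qed

lemma sets_configuration: "\<phi> \<in> configurations \<Longrightarrow> sets \<phi> = sets borel"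
  by (simp add: configurations_def)

lemma add_point_in_configurations:
  assumes "\<phi> \<in> configurations"
  shows "add_point \<phi> x \<in> configurations"
proof -
  have s: "sets (add_point \<phi> x) = sets borel"
    unfolding add_point_def
    by (simp add: sets.sigma_sets_eq[of borel, simplified])
  show ?thesis
    unfolding configurations_def
  proof (intro CollectI conjI ballI impI s)
    fix A :: "'a set" assume A: "A \<in> sets borel"
    have i: "indicator A x = (of_nat (if x \<in> A then 1 else 0) :: ennreal)" by simp
    have "emeasure \<phi> A = \<infinity> \<or> (\<exists>k::nat. emeasure \<phi> A = of_nat k)"
      using A assms by (simp add: configurations_def)
    then show "emeasure (add_point \<phi> x) A = \<infinity> \<or> (\<exists>k::nat. emeasure (add_point \<phi> x) A = of_nat k)"
      unfolding emeasure_add_point[OF assms A] i by (metis of_nat_add infinity_ennreal_def ennreal_add_eq_top)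
  next
    fix A :: "'a set" assume A: "A \<in> sets borel" "relatively_compact A"
    then have "emeasure \<phi> A < \<infinity>" using assms by (simp add: configurations_def)
    then show "emeasure (add_point \<phi> x) A < \<infinity>"
      unfolding emeasure_add_point[OF assms A(1)] by (auto simp: indicator_def)
  qed
qed

lemma measurable_add_point:
  "(\<lambda>p. add_point (fst p) (snd p)) \<in>
     measurable (config_space \<Otimes>\<^sub>M borel) (config_space :: 'a::metric_space measure measure)"
proof (rule measurable_config_spaceI)
  fix p :: "'a measure \<times> 'a" assume "p \<in> space (config_space \<Otimes>\<^sub>M borel)"
  then show "add_point (fst p) (snd p) \<in> configurations"
    by (auto simp: space_pair_measure space_config_space intro: add_point_in_configurations)
next
  fix A :: "'a set" assume A: "A \<in> sets borel" "relatively_compact A"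
  note measurable_emeasure_config[OF A, measurable]
  note A(1)[measurable]
  have "(\<lambda>p. emeasure (fst p) A + indicator A (snd p)) \<in> borel_measurable (config_space \<Otimes>\<^sub>M borel)"
    by measurable
  then show "(\<lambda>p. emeasure (add_point (fst p) (snd p)) A) \<in> borel_measurable (config_space \<Otimes>\<^sub>M borel)"
    by (rule measurable_cong[THEN iffD1, rotated])
      (auto simp: space_pair_measure space_config_space emeasure_add_point A)
qed

subsection \<open>Configurations from finite samples\<close>

text \<open>A slot \<open>(n, x)\<close> stands for the finite configuration with the points \<open>x 0, \<dots>, x (n - 1)\<close>.\<close>

definition slot_count :: "nat \<times> (nat \<Rightarrow> 'a) \<Rightarrow> 'a set \<Rightarrow> nat" where
  "slot_count s A = card {j. j < fst s \<and> snd s j \<in> A}"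

text \<open>The pushforward starts from index pairs and not from the set of points, so coinciding
  points keep their multiplicity; \<open>D\<close> below may have atoms.\<close>

definition superpose :: "nat \<Rightarrow> (nat \<Rightarrow> nat \<times> (nat \<Rightarrow> 'a)) \<Rightarrow> 'a::metric_space measure" where
  "superpose k y =
     distr (count_space (SIGMA i:{..<k}. {..<fst (y i)})) borel (\<lambda>(i, j). snd (y i) j)"

lemma slot_count_le: "slot_count s A \<le> fst s"
proof -
  have "slot_count s A \<le> card {..<fst s}"
    unfolding slot_count_def by (intro card_mono) auto
  then show ?thesis by simp
qed

lemma slot_count_eq_sum: "slot_count s A = (\<Sum>j<fst s. if snd s j \<in> A then 1 else 0)"
  unfolding slot_count_def by (simp add: sum.If_cases Int_def)

lemma sets_superpose [simp]: "sets (superpose k y) = sets borel"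
  by (simp add: superpose_def)

lemma emeasure_superpose:
  assumes "A \<in> sets borel"
  shows "emeasure (superpose k y) A = of_nat (\<Sum>i<k. slot_count (y i) A)"
proof -
  let ?S = "SIGMA i:{..<k}. {..<fst (y i)}"
  have e: "(\<lambda>(i, j). snd (y i) j) -` A \<inter> ?S = (SIGMA i:{..<k}. {j. j < fst (y i) \<and> snd (y i) j \<in> A})"
    by auto
  have "emeasure (superpose k y) A = emeasure (count_space ?S) ((\<lambda>(i, j). snd (y i) j) -` A \<inter> ?S)"
    unfolding superpose_def using assms by (subst emeasure_distr) auto
  also have "\<dots> = of_nat (card ((\<lambda>(i, j). snd (y i) j) -` A \<inter> ?S))"
    by (subst emeasure_count_space_finite) auto
  also have "card ((\<lambda>(i, j). snd (y i) j) -` A \<inter> ?S) = (\<Sum>i<k. slot_count (y i) A)"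
    unfolding e by (subst card_SigmaI) (auto simp: slot_count_def)
  finally show ?thesis .
qed

lemma measure_superpose:
  "A \<in> sets borel \<Longrightarrow> measure (superpose k y) A = real (\<Sum>i<k. slot_count (y i) A)"
  unfolding measure_def emeasure_superpose ennreal_of_nat_eq_real_of_nat by (rule enn2real_ennreal) (rule of_nat_0_le_iff)

lemma superpose_in_configurations: "superpose k y \<in> configurations"
  by (auto simp: configurations_def emeasure_superpose of_nat_less_top simp del: of_nat_sum)

text \<open>The other slots keep their counts and the empty slot had none. This is the link between
  slots and \<open>add_point\<close>, used for additions and, with old and new state exchanged, for
  deletions.\<close>

lemma superpose_add_point:
  assumes "i < k" "fst (y i) = 0" "fst s = 1"
  shows "superpose k (y(i := s)) = add_point (superpose k y) (snd s 0)"
proof (rule measure_eqI)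
  show "sets (superpose k (y(i := s))) = sets (add_point (superpose k y) (snd s 0))"
    by (simp add: sets_configuration[OF add_point_in_configurations] superpose_in_configurations)
  fix A assume "A \<in> sets (superpose k (y(i := s)))"
  then have A: "A \<in> sets borel" by simp
  have "(\<Sum>l<k. slot_count ((y(i := s)) l) A) = slot_count s A + (\<Sum>l\<in>{..<k}-{i}. slot_count (y l) A)"
    using assms(1) by (subst sum.remove[of _ i]) auto
  moreover have "(\<Sum>l<k. slot_count (y l) A) = slot_count (y i) A + (\<Sum>l\<in>{..<k}-{i}. slot_count (y l) A)"
    using assms(1) by (subst sum.remove[of _ i]) auto
  moreover have "slot_count (y i) A = 0" "slot_count s A = (if snd s 0 \<in> A then 1 else 0)"
    using assms by (auto simp: slot_count_eq_sum)
  ultimately show "emeasure (superpose k (y(i := s))) A = emeasure (add_point (superpose k y) (snd s 0)) A"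
    by (simp add: emeasure_add_point superpose_in_configurations A emeasure_superpose)
qed

text \<open>Differences of counts add up slot by slot. The bound \<open>c\<close> must serve all
  \<open>A\<close> at once, because \<open>tv_dist\<close> is a supremum.\<close>

lemma tv_dist_superpose_le:
  assumes "\<And>A. (\<Sum>i<k. \<bar>real (slot_count (y i) A) - real (slot_count (z i) A)\<bar>) \<le> real c"
  shows "tv_dist (superpose k y) (superpose k z) \<le> of_nat c"
  unfolding tv_dist_def
proof (rule SUP_least)
  fix A assume "A \<in> {A \<in> sets borel. emeasure (superpose k y) A < \<infinity> \<and> emeasure (superpose k z) A < \<infinity>}"
  then have A: "A \<in> sets borel" by simp
  have "\<bar>measure (superpose k y) A - measure (superpose k z) A\<bar>
      = \<bar>\<Sum>i<k. real (slot_count (y i) A) - real (slot_count (z i) A)\<bar>"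
    by (simp add: measure_superpose A sum_subtractf)
  also have "\<dots> \<le> real c"
    by (rule order_trans[OF sum_abs assms])
  finally show "ennreal \<bar>measure (superpose k y) A - measure (superpose k z) A\<bar> \<le> of_nat c"
    by (simp add: ennreal_of_nat_eq_real_of_nat ennreal_leI)
qed

subsection \<open>Uniqueness of joint probability generating functions\<close>

text \<open>By induction the coefficients below \<open>n\<close> vanish, so the series divided by
  \<open>z ^ n\<close> is still zero on the interval, while it tends to \<open>d n\<close> as
  \<open>z\<close> decreases to 0. Boundedness supplies convergence on the open unit disc.\<close>

lemma power_series_zero_on_interval:
  fixes d :: "nat \<Rightarrow> real"
  assumes bound: "\<And>n. \<bar>d n\<bar> \<le> B"
    and zero: "\<And>z. 0 < z \<Longrightarrow> z < 1 \<Longrightarrow> (\<Sum>n. d n * z ^ n) = 0"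
  shows "d n = 0"
proof (induction n rule: less_induct)
  case (less n)
  have summ: "summable (\<lambda>m. d (m + j) * z ^ m)" if "\<bar>z\<bar> < 1" for z j
  proof (rule summable_comparison_test')
    show "summable (\<lambda>m. B * \<bar>z\<bar> ^ m)"
      using that by (intro summable_mult summable_geometric) auto
    show "norm (d (m + j) * z ^ m) \<le> B * \<bar>z\<bar> ^ m" if "m \<ge> 0" for m
      using bound[of "m + j"] by (simp add: abs_mult power_abs mult_right_mono)
  qed
  define f where "f z = (\<Sum>m. d (m + n) * z ^ m)" for z
  have "(f \<longlongrightarrow> d (0 + n)) (at 0)"
    by (rule powser_limit_0[of 1]) (auto simp: f_def intro!: summable_sums summ)
  then have lim: "(f \<longlongrightarrow> d n) (at_right 0)"
    by (simp add: filterlim_at_split)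
  have "f z = 0" if "0 < z" "z < 1" for z
  proof -
    have "0 = (\<Sum>m. d (m + n) * z ^ (m + n)) + (\<Sum>m<n. d m * z ^ m)"
      using zero[OF that] suminf_split_initial_segment[of "\<lambda>m. d m * z ^ m" n] summ[of z 0] that
      by simp
    also have "(\<Sum>m<n. d m * z ^ m) = 0"
      using less by (intro sum.neutral) auto
    also have "(\<Sum>m. d (m + n) * z ^ (m + n)) = (\<Sum>m. z ^ n * (d (m + n) * z ^ m))"
      by (simp add: power_add mult_ac)
    also have "\<dots> = z ^ n * f z"
      unfolding f_def using that by (intro suminf_mult summ) auto
    finally show ?thesis using that by simp
  qed
  then have "eventually (\<lambda>z. f z = 0) (at_right 0)"
    unfolding eventually_at_right[OF zero_less_one] by (intro exI[of _ 1]) auto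
  then have "(f \<longlongrightarrow> 0) (at_right 0)"
    using tendsto_eventually by blast
  then show "d n = 0"
    using lim tendsto_unique by (metis trivial_limit_at_right_real)
qed

text \<open>The common bound makes all coefficients finite, so the two series can be subtracted over
  the reals.\<close>

lemma ennreal_power_series_unique:
  fixes \<alpha> \<beta> :: "nat \<Rightarrow> ennreal"
  assumes bounds: "\<And>n. \<alpha> n \<le> ennreal B" "\<And>n. \<beta> n \<le> ennreal B"
    and eq: "\<And>z. 0 < z \<Longrightarrow> z < 1 \<Longrightarrow> (\<Sum>n. \<alpha> n * ennreal (z ^ n)) = (\<Sum>n. \<beta> n * ennreal (z ^ n))"
  shows "\<alpha> n = \<beta> n"
proof -
  define B' where "B' = max B 0"
  have B': "B' \<ge> 0" "\<And>n. \<alpha> n \<le> ennreal B'" "\<And>n. \<beta> n \<le> ennreal B'"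
    using bounds by (auto simp: B'_def max_def ennreal_neg)
  define a b where "a n = enn2real (\<alpha> n)" and "b n = enn2real (\<beta> n)" for n
  have fin: "\<alpha> n < top" "\<beta> n < top" for n
    using B'(2,3)[of n] by (auto intro: le_less_trans)
  have ab: "\<alpha> n = ennreal (a n)" "\<beta> n = ennreal (b n)" "0 \<le> a n" "a n \<le> B'" "0 \<le> b n" "b n \<le> B'" for n
    using fin[of n] B'(2,3)[of n] B'(1) by (auto simp: a_def b_def enn2real_leI)
  have summ: "summable (\<lambda>n. x n * z ^ n)" if "\<And>n. 0 \<le> x n" "\<And>n. x n \<le> B'" "0 < z" "z < 1" for x and z :: real
  proof (rule summable_comparison_test')
    show "summable (\<lambda>m. B' * z ^ m)"
      using that by (intro summable_mult summable_geometric) auto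
    show "norm (x m * z ^ m) \<le> B' * z ^ m" if "m \<ge> 0" for m
      using \<open>\<And>n. 0 \<le> x n\<close>[of m] \<open>\<And>n. x n \<le> B'\<close>[of m] \<open>0 < z\<close> by (simp add: abs_mult mult_right_mono)
  qed
  have "a n - b n = 0"
  proof (rule power_series_zero_on_interval[where d = "\<lambda>n. a n - b n" and B = B'])
    show "\<bar>a n - b n\<bar> \<le> B'" for n
      using ab[of n] by auto
    fix z :: real assume z: "0 < z" "z < 1"
    have s: "summable (\<lambda>n. a n * z ^ n)" "summable (\<lambda>n. b n * z ^ n)"
      using ab z by (auto intro!: summ)
    have "ennreal (\<Sum>n. a n * z ^ n) = (\<Sum>n. \<alpha> n * ennreal (z ^ n))"
      using ab z s by (subst suminf_ennreal2[symmetric]) (auto simp: ennreal_mult)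
    also have "\<dots> = (\<Sum>n. \<beta> n * ennreal (z ^ n))" by (rule eq[OF z])
    also have "\<dots> = ennreal (\<Sum>n. b n * z ^ n)"
      using ab z s by (subst suminf_ennreal2[symmetric]) (auto simp: ennreal_mult)
    finally have "(\<Sum>n. a n * z ^ n) = (\<Sum>n. b n * z ^ n)"
      using ab z s by (subst (asm) ennreal_inj) (auto intro!: suminf_nonneg)
    then show "(\<Sum>n. (a n - b n) * z ^ n) = 0"
      using suminf_diff[OF s] by (simp add: left_diff_distrib)
  qed
  then show ?thesis by (simp add: ab)
qed

text \<open>Partitioning by the value of \<open>N\<close> is what turns a generating function into a
  power series.\<close>

lemma nn_integral_countable_split:
  fixes N :: "'s \<Rightarrow> nat"
  assumes [measurable]: "N \<in> measurable M (count_space UNIV)" "\<And>n. g n \<in> borel_measurable M"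
  shows "(\<integral>\<^sup>+x. g (N x) x \<partial>M) = (\<Sum>n. \<integral>\<^sup>+x. indicator {x \<in> space M. N x = n} x * g n x \<partial>M)"
proof -
  have "(\<integral>\<^sup>+x. g (N x) x \<partial>M) = (\<integral>\<^sup>+x. (\<Sum>n. indicator {x \<in> space M. N x = n} x * g n x) \<partial>M)"
  proof (rule nn_integral_cong)
    fix x assume "x \<in> space M"
    then have "(\<Sum>n. indicator {x \<in> space M. N x = n} x * g n x) = (\<Sum>n\<in>{N x}. indicator {x \<in> space M. N x = n} x * g n x)"
      by (intro suminf_finite) auto
    then show "g (N x) x = (\<Sum>n. indicator {x \<in> space M. N x = n} x * g n x)"
      using \<open>x \<in> space M\<close> by simp
  qed
  also have "\<dots> = (\<Sum>n. \<integral>\<^sup>+x. indicator {x \<in> space M. N x = n} x * g n x \<partial>M)"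
    by (intro nn_integral_suminf) measurable
  finally show ?thesis .
qed

text \<open>Induction on the number of variables: in the variable of \<open>a\<close>, the
  generating function is a power series whose coefficients are generating functions, in the
  remaining variables, of the measure restricted to \<open>N a = n\<close>. Restrictions are not
  normalised, hence finite measures instead of probabilities.\<close>

lemma joint_pgf_unique:
  fixes N :: "'i \<Rightarrow> 's \<Rightarrow> nat"
  assumes "finite I" "finite_measure \<mu>" "finite_measure \<nu>" "sets \<mu> = sets \<nu>"
    and "\<And>i. i \<in> I \<Longrightarrow> N i \<in> measurable \<mu> (count_space UNIV)"
    and "\<And>z. (\<And>i. i \<in> I \<Longrightarrow> 0 < z i \<and> z i < 1) \<Longrightarrow>
      (\<integral>\<^sup>+x. (\<Prod>i\<in>I. ennreal (z i ^ N i x)) \<partial>\<mu>) = (\<integral>\<^sup>+x. (\<Prod>i\<in>I. ennreal (z i ^ N i x)) \<partial>\<nu>)"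
  shows "emeasure \<mu> {x \<in> space \<mu>. \<forall>i\<in>I. N i x = c i} = emeasure \<nu> {x \<in> space \<nu>. \<forall>i\<in>I. N i x = c i}"
  using assms
proof (induction I arbitrary: \<mu> \<nu> rule: finite_induct)
  case empty
  show ?case using empty(5)[of "\<lambda>_. 1"] by simp
next
  case (insert a I)
  interpret \<mu>: finite_measure \<mu> by fact
  interpret \<nu>: finite_measure \<nu> by fact
  note sets[measurable_cong] = \<open>sets \<mu> = sets \<nu>\<close>
  have sp: "space \<mu> = space \<nu>" using sets by (rule sets_eq_imp_space_eq)
  have N[measurable]: "N i \<in> measurable \<mu> (count_space UNIV)" if "i \<in> insert a I" for i
    using insert.prems(4) that by blast
  have N'[measurable]: "N i \<in> measurable \<nu> (count_space UNIV)" if "i \<in> insert a I" for i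
    using N[OF that] by (simp cong: measurable_cong_sets[OF sets])
  have Na[measurable]: "N a \<in> measurable \<mu> (count_space UNIV)" "N a \<in> measurable \<nu> (count_space UNIV)"
    by (auto intro: N N')
  define E where "E n = {x \<in> space \<mu>. N a x = n}" for n
  have E\<mu>: "E n \<in> sets \<mu>" for n
    unfolding E_def by measurable
  have E[measurable]: "E n \<in> sets \<mu>" "E n \<in> sets \<nu>" for n
    using E\<mu>[of n] sets by auto
  have IH: "emeasure (density \<mu> (indicator (E (c a)))) {x \<in> space (density \<mu> (indicator (E (c a)))). \<forall>i\<in>I. N i x = c i}
      = emeasure (density \<nu> (indicator (E (c a)))) {x \<in> space (density \<nu> (indicator (E (c a)))). \<forall>i\<in>I. N i x = c i}"
  proof (rule insert.IH)
    show "finite_measure (density \<mu> (indicator (E (c a))))"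
      by (rule finite_measureI) (simp add: emeasure_density)
    show "finite_measure (density \<nu> (indicator (E (c a))))"
      by (rule finite_measureI) (simp add: emeasure_density)
    show "sets (density \<mu> (indicator (E (c a)))) = sets (density \<nu> (indicator (E (c a))))"
      using sets by simp
    show "N i \<in> measurable (density \<mu> (indicator (E (c a)))) (count_space UNIV)" if "i \<in> I" for i
      using N[of i] that by simp
    fix z :: "'i \<Rightarrow> real" assume z: "\<And>i. i \<in> I \<Longrightarrow> 0 < z i \<and> z i < 1"
    let ?p = "\<lambda>x. \<Prod>i\<in>I. ennreal (z i ^ N i x)"
    have p[measurable]: "?p \<in> borel_measurable \<mu>" "?p \<in> borel_measurable \<nu>"
    proof -
      have "?p \<in> borel_measurable \<rho>" if "\<And>i. i \<in> I \<Longrightarrow> N i \<in> measurable \<rho> (count_space UNIV)" for \<rho>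
      proof (rule borel_measurable_prod_ennreal)
        fix i assume "i \<in> I"
        note that[OF this, measurable]
        show "(\<lambda>x. ennreal (z i ^ N i x)) \<in> borel_measurable \<rho>" by measurable
      qed
      then show "?p \<in> borel_measurable \<mu>" "?p \<in> borel_measurable \<nu>"
        using N N' by auto
    qed
    have p1: "?p x \<le> 1" for x
    proof -
      have "?p x \<le> (\<Prod>i\<in>I. 1)"
        using z by (intro prod_mono_ennreal) (auto simp: ennreal_le_1 power_le_one less_imp_le)
      then show ?thesis by simp
    qed
    define B where "B = max (measure \<mu> (space \<mu>)) (measure \<nu> (space \<nu>))"
    \<comment> \<open>The remaining variables are frozen at \<open>z\<close>; of all the
      coefficients in the variable of \<open>a\<close>, the one of index \<open>c a\<close> is the
      one wanted.\<close>
    have "(\<integral>\<^sup>+x. indicator (E (c a)) x * ?p x \<partial>\<mu>) = (\<integral>\<^sup>+x. indicator (E (c a)) x * ?p x \<partial>\<nu>)"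
    proof (rule ennreal_power_series_unique[where B = B])
      fix n
      have "(\<integral>\<^sup>+x. indicator (E n) x * ?p x \<partial>\<mu>) \<le> (\<integral>\<^sup>+x. 1 \<partial>\<mu>)"
        using p1 by (intro nn_integral_mono) (auto simp: indicator_def)
      also have "\<dots> \<le> ennreal B"
        by (simp add: \<mu>.emeasure_eq_measure B_def ennreal_leI)
      finally show "(\<integral>\<^sup>+x. indicator (E n) x * ?p x \<partial>\<mu>) \<le> ennreal B" .
      have "(\<integral>\<^sup>+x. indicator (E n) x * ?p x \<partial>\<nu>) \<le> (\<integral>\<^sup>+x. 1 \<partial>\<nu>)"
        using p1 by (intro nn_integral_mono) (auto simp: indicator_def)
      also have "\<dots> \<le> ennreal B"
        by (simp add: \<nu>.emeasure_eq_measure B_def ennreal_leI)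
      finally show "(\<integral>\<^sup>+x. indicator (E n) x * ?p x \<partial>\<nu>) \<le> ennreal B" .
    next
      fix \<zeta> :: real assume \<zeta>: "0 < \<zeta>" "\<zeta> < 1"
      have *: "(\<integral>\<^sup>+x. (\<Prod>i\<in>insert a I. ennreal ((z(a := \<zeta>)) i ^ N i x)) \<partial>\<rho>)
          = (\<Sum>n. (\<integral>\<^sup>+x. indicator (E n) x * ?p x \<partial>\<rho>) * ennreal (\<zeta> ^ n))"
        if \<rho>: "\<rho> = \<mu> \<or> \<rho> = \<nu>" for \<rho>
      proof -
        have [measurable]: "N a \<in> measurable \<rho> (count_space UNIV)" "?p \<in> borel_measurable \<rho>" "E n \<in> sets \<rho>" for n
          using \<rho> p Na E by auto
        have sr: "space \<rho> = space \<mu>" using \<rho> sp by auto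
        have "(\<Prod>i\<in>I. ennreal ((z(a := \<zeta>)) i ^ N i x)) = ?p x" for x
          using insert.hyps by (intro prod.cong) auto
        then have "(\<integral>\<^sup>+x. (\<Prod>i\<in>insert a I. ennreal ((z(a := \<zeta>)) i ^ N i x)) \<partial>\<rho>)
            = (\<integral>\<^sup>+x. (\<lambda>n x. ennreal (\<zeta> ^ n) * ?p x) (N a x) x \<partial>\<rho>)"
          using insert.hyps by (intro nn_integral_cong) simp
        also have "\<dots> = (\<Sum>n. \<integral>\<^sup>+x. indicator {x \<in> space \<rho>. N a x = n} x * (ennreal (\<zeta> ^ n) * ?p x) \<partial>\<rho>)"
          by (rule nn_integral_countable_split) measurable
        also have "\<dots> = (\<Sum>n. (\<integral>\<^sup>+x. indicator (E n) x * ?p x \<partial>\<rho>) * ennreal (\<zeta> ^ n))"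
        proof (rule suminf_cong)
          fix n
          show "(\<integral>\<^sup>+x. indicator {x \<in> space \<rho>. N a x = n} x * (ennreal (\<zeta> ^ n) * ?p x) \<partial>\<rho>)
              = (\<integral>\<^sup>+x. indicator (E n) x * ?p x \<partial>\<rho>) * ennreal (\<zeta> ^ n)"
            unfolding sr E_def[symmetric]
            by (subst nn_integral_multc[symmetric]) (auto simp: ac_simps)
        qed
        finally show ?thesis .
      qed
      have "(\<integral>\<^sup>+x. (\<Prod>i\<in>insert a I. ennreal ((z(a := \<zeta>)) i ^ N i x)) \<partial>\<mu>)
          = (\<integral>\<^sup>+x. (\<Prod>i\<in>insert a I. ennreal ((z(a := \<zeta>)) i ^ N i x)) \<partial>\<nu>)"
        using z \<zeta> by (intro insert.prems(5)) auto
      then show "(\<Sum>n. (\<integral>\<^sup>+x. indicator (E n) x * ?p x \<partial>\<mu>) * ennreal (\<zeta> ^ n))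
          = (\<Sum>n. (\<integral>\<^sup>+x. indicator (E n) x * ?p x \<partial>\<nu>) * ennreal (\<zeta> ^ n))"
        using *[of \<mu>] *[of \<nu>] by simp
    qed
    then show "(\<integral>\<^sup>+x. ?p x \<partial>density \<mu> (indicator (E (c a)))) = (\<integral>\<^sup>+x. ?p x \<partial>density \<nu> (indicator (E (c a))))"
      by (subst (1 2) nn_integral_density) auto
  qed
  have **: "emeasure (density \<rho> (indicator (E (c a)))) {x \<in> space (density \<rho> (indicator (E (c a)))). \<forall>i\<in>I. N i x = c i}
      = emeasure \<rho> {x \<in> space \<rho>. \<forall>i\<in>insert a I. N i x = c i}" if \<rho>: "\<rho> = \<mu> \<or> \<rho> = \<nu>" for \<rho>
  proof -
    have [measurable]: "N i \<in> measurable \<rho> (count_space UNIV)" if "i \<in> insert a I" for i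
      using \<rho> N[OF that] N'[OF that] by auto
    have [measurable]: "E n \<in> sets \<rho>" for n using \<rho> E by auto
    have F: "{x \<in> space \<rho>. \<forall>i\<in>I. N i x = c i} \<in> sets \<rho>"
      using insert.hyps(1) by (intro sets.sets_Collect_finite_All) auto
    have G: "E (c a) \<inter> {x \<in> space \<rho>. \<forall>i\<in>I. N i x = c i} = {x \<in> space \<rho>. \<forall>i\<in>insert a I. N i x = c i}"
      using \<rho> sp by (auto simp: E_def)
    have "emeasure (density \<rho> (indicator (E (c a)))) {x \<in> space \<rho>. \<forall>i\<in>I. N i x = c i}
        = emeasure \<rho> (E (c a) \<inter> {x \<in> space \<rho>. \<forall>i\<in>I. N i x = c i})"
      using F by (simp add: emeasure_density indicator_inter_arith[symmetric])
    then show ?thesis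
      unfolding G by simp
  qed
  show ?case using IH **[of \<mu>] **[of \<nu>] by simp
qed

subsection \<open>Laws of point processes are determined by Laplace functionals\<close>

text \<open>Number of points in \<open>A\<close>; meaningful only when \<open>\<phi> A\<close> is finite.\<close>

definition point_count :: "'a measure \<Rightarrow> 'a set \<Rightarrow> nat" where
  "point_count \<phi> A = nat \<lfloor>measure \<phi> A\<rfloor>"

lemma point_count:
  assumes "\<phi> \<in> configurations" "A \<in> sets borel" "relatively_compact A"
  shows "emeasure \<phi> A = of_nat (point_count \<phi> A)" "measure \<phi> A = real (point_count \<phi> A)"
proof -
  obtain n :: nat where n: "emeasure \<phi> A = of_nat n"
    using assms unfolding configurations_def by fastforce
  then have "measure \<phi> A = real n"
    by (simp add: measure_def ennreal_of_nat_eq_real_of_nat)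
  then show "emeasure \<phi> A = of_nat (point_count \<phi> A)" "measure \<phi> A = real (point_count \<phi> A)"
    using n by (simp_all add: point_count_def)
qed

lemma measurable_measure_config:
  assumes "A \<in> sets borel" "relatively_compact A"
  shows "(\<lambda>\<phi>. measure \<phi> A) \<in> borel_measurable config_space"
  unfolding measure_def using measurable_emeasure_config[OF assms] by measurable

lemma measurable_point_count:
  assumes "A \<in> sets borel" "relatively_compact A"
  shows "(\<lambda>\<phi>. point_count \<phi> A) \<in> measurable config_space (count_space UNIV)"
  unfolding point_count_def using measurable_measure_config[OF assms] by measurable

definition count_cylinder :: "'a set set \<Rightarrow> ('a set \<Rightarrow> nat) \<Rightarrow> 'a::metric_space measure set" where
  "count_cylinder I c = {\<phi> \<in> configurations. \<forall>A\<in>I. point_count \<phi> A = c A}"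

text \<open>Two cylinders that prescribe different counts on the same set have an empty
  intersection; adding the empty set makes the family stable under intersections.\<close>

definition count_cylinders :: "'a::metric_space measure set set" where
  "count_cylinders = insert {} {count_cylinder I c | I c.
     finite I \<and> (\<forall>A\<in>I. A \<in> sets borel \<and> relatively_compact A)}"

lemma count_cylinder_sets:
  assumes "finite I" "\<forall>A\<in>I. A \<in> sets borel \<and> relatively_compact A"
  shows "count_cylinder I c \<in> sets config_space"
proof -
  have "{\<phi> \<in> space config_space. \<forall>A\<in>I. point_count \<phi> A = c A} \<in> sets config_space"
  proof (rule sets.sets_Collect_finite_All[OF _ assms(1)])
    fix A assume "A \<in> I"
    then have "(\<lambda>\<phi>. point_count \<phi> A) \<in> measurable config_space (count_space UNIV)"
      using assms by (intro measurable_point_count) auto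
    then show "{\<phi> \<in> space config_space. point_count \<phi> A = c A} \<in> sets config_space"
      by measurable
  qed
  then show ?thesis by (simp add: count_cylinder_def space_config_space)
qed

lemma Int_stable_count_cylinders: "Int_stable count_cylinders"
proof (rule Int_stableI)
  fix X Y :: "'a measure set"
  assume "X \<in> count_cylinders" "Y \<in> count_cylinders"
  show "X \<inter> Y \<in> count_cylinders"
  proof (cases "X \<inter> Y = {}")
    case True
    then show ?thesis by (simp add: count_cylinders_def)
  next
    case False
    then obtain I c J d where
      X: "X = count_cylinder I c" "finite I" "\<forall>A\<in>I. A \<in> sets borel \<and> relatively_compact A" and
      Y: "Y = count_cylinder J d" "finite J" "\<forall>A\<in>J. A \<in> sets borel \<and> relatively_compact A"
      using \<open>X \<in> count_cylinders\<close> \<open>Y \<in> count_cylinders\<close> unfolding count_cylinders_def by blast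
    obtain \<phi> where "\<phi> \<in> X" "\<phi> \<in> Y" using False by blast
    then have "c A = d A" if "A \<in> I" "A \<in> J" for A
      using that X Y by (auto simp: count_cylinder_def)
    then have "X \<inter> Y = count_cylinder (I \<union> J) (\<lambda>A. if A \<in> I then c A else d A)"
      unfolding X(1) Y(1) count_cylinder_def by auto
    then show ?thesis
      unfolding count_cylinders_def using X Y by blast
  qed
qed

text \<open>On a relatively compact set the count is a natural number, so each generator is a
  countable union of cylinders over a single set.\<close>

lemma sets_config_space_cylinders:
  "sets (config_space :: 'a::metric_space measure measure) = sigma_sets configurations count_cylinders"
  unfolding sets_config_space
proof (rule sigma_sets_eqI)
  fix S :: "'a measure set"
  assume "S \<in> {{\<phi> \<in> configurations. emeasure \<phi> A \<in> B} | A B.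
      A \<in> sets borel \<and> relatively_compact A \<and> B \<in> sets borel}"
  then obtain A B where S: "S = {\<phi> \<in> configurations. emeasure \<phi> A \<in> B}"
    and A: "A \<in> sets borel" "relatively_compact A" by blast
  have "S = (\<Union>n\<in>{n. of_nat n \<in> B}. count_cylinder {A} (\<lambda>_. n))"
    unfolding S count_cylinder_def using point_count(1)[OF _ A] by auto
  moreover have "count_cylinder {A} (\<lambda>_. n) \<in> sigma_sets configurations count_cylinders" for n
    using A by (intro sigma_sets.Basic) (auto simp: count_cylinders_def)
  ultimately show "S \<in> sigma_sets configurations count_cylinders"
    by (auto intro!: sigma_sets_UNION)
next
  fix S :: "'a measure set" assume "S \<in> count_cylinders"
  then show "S \<in> sigma_sets configurations {{\<phi> \<in> configurations. emeasure \<phi> A \<in> B} | A B.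
      A \<in> sets borel \<and> relatively_compact A \<and> B \<in> sets borel}"
    unfolding sets_config_space[symmetric] by (auto simp: count_cylinders_def count_cylinder_sets)
qed

text \<open>The Laplace functional of \<open>P\<close> at the step function with values
  \<open>t i\<close> on \<open>A i\<close>. The index type is free because the step functions are
  indexed both by the sets themselves and by numbers.\<close>

definition laplace :: "'a measure measure \<Rightarrow> 'i set \<Rightarrow> ('i \<Rightarrow> real) \<Rightarrow> ('i \<Rightarrow> 'a set) \<Rightarrow> ennreal" where
  "laplace P I t A = (\<integral>\<^sup>+\<phi>. ennreal (exp (- (\<Sum>i\<in>I. t i * measure \<phi> (A i)))) \<partial>P)"

text \<open>Putting \<open>t A = - ln (z A)\<close> makes the Laplace functional the joint
  generating function of the counts, with \<open>z A\<close> between 0 and 1 exactly for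
  \<open>t A\<close> positive. This determines the probabilities of cylinders, and these generate.
  The sets in \<open>I\<close> may overlap.\<close>

lemma config_law_eqI:
  fixes P1 P2 :: "'a::metric_space measure measure"
  assumes P: "prob_space P1" "prob_space P2" "sets P1 = sets config_space" "sets P2 = sets config_space"
    and L: "\<And>(I :: 'a set set) t. finite I \<Longrightarrow>
      \<forall>A\<in>I. A \<in> sets borel \<and> relatively_compact A \<and> 0 < t A \<Longrightarrow>
      laplace P1 I t (\<lambda>A. A) = laplace P2 I t (\<lambda>A. A)"
  shows "P1 = P2"
proof (rule measure_eqI_generator_eq[OF Int_stable_count_cylinders, where A = "\<lambda>_. configurations"])
  interpret P1: prob_space P1 by fact
  interpret P2: prob_space P2 by fact
  have sp: "space P1 = configurations" "space P2 = configurations"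
    using P(3,4)[THEN sets_eq_imp_space_eq] by (simp_all add: space_config_space)
  show "count_cylinders \<subseteq> Pow (configurations :: 'a measure set)"
    by (auto simp: count_cylinders_def count_cylinder_def)
  show "sets P1 = sigma_sets configurations count_cylinders" "sets P2 = sigma_sets configurations count_cylinders"
    using P sets_config_space_cylinders by auto
  have "configurations = count_cylinder {} (\<lambda>_. 0)" by (simp add: count_cylinder_def)
  then show "range (\<lambda>_. configurations) \<subseteq> (count_cylinders :: 'a measure set set)"
    unfolding count_cylinders_def by (auto simp del: ex_simps)
  show "(\<Union>i. configurations) = (configurations :: 'a measure set)" by simp
  show "emeasure P1 configurations \<noteq> \<infinity>" by simp
  fix X :: "'a measure set" assume "X \<in> count_cylinders"
  then consider "X = {}" | I c where "X = count_cylinder I c" "finite I" "\<forall>A\<in>I. A \<in> sets borel \<and> relatively_compact A"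
    by (auto simp: count_cylinders_def)
  then show "emeasure P1 X = emeasure P2 X"
  proof cases
    case 2
    have "emeasure P1 {\<phi> \<in> space P1. \<forall>A\<in>I. point_count \<phi> A = c A} = emeasure P2 {\<phi> \<in> space P2. \<forall>A\<in>I. point_count \<phi> A = c A}"
    proof (rule joint_pgf_unique)
      show "sets P1 = sets P2" using P by simp
      show "(\<lambda>\<phi>. point_count \<phi> A) \<in> measurable P1 (count_space UNIV)" if "A \<in> I" for A
        using 2 that measurable_point_count[of A] P(3) by (simp cong: measurable_cong_sets)
      fix z :: "'a set \<Rightarrow> real" assume z: "\<And>A. A \<in> I \<Longrightarrow> 0 < z A \<and> z A < 1"
      have *: "(\<integral>\<^sup>+\<phi>. (\<Prod>A\<in>I. ennreal (z A ^ point_count \<phi> A)) \<partial>P) = laplace P I (\<lambda>A. - ln (z A)) (\<lambda>A. A)"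
        if "space P = configurations" for P
        unfolding laplace_def
      proof (rule nn_integral_cong)
        fix \<phi> assume "\<phi> \<in> space P"
        then have "\<phi> \<in> configurations" using that by simp
        then have "exp (- (\<Sum>A\<in>I. - ln (z A) * measure \<phi> A)) = exp (\<Sum>A\<in>I. real (point_count \<phi> A) * ln (z A))"
          using 2 by (simp add: sum_negf[symmetric] point_count(2) mult.commute cong: sum.cong)
        also have "\<dots> = (\<Prod>A\<in>I. z A ^ point_count \<phi> A)"
          using z 2 by (auto simp: exp_sum exp_of_nat_mult intro!: prod.cong)
        finally show "(\<Prod>A\<in>I. ennreal (z A ^ point_count \<phi> A)) = ennreal (exp (- (\<Sum>A\<in>I. - ln (z A) * measure \<phi> A)))"
          using z by (simp add: prod_ennreal less_imp_le)
      qed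
      show "(\<integral>\<^sup>+\<phi>. (\<Prod>A\<in>I. ennreal (z A ^ point_count \<phi> A)) \<partial>P1) = (\<integral>\<^sup>+\<phi>. (\<Prod>A\<in>I. ennreal (z A ^ point_count \<phi> A)) \<partial>P2)"
        unfolding *[OF sp(1)] *[OF sp(2)] using 2 z by (intro L) auto
    qed (use 2 in \<open>auto intro: P1.finite_measure_axioms P2.finite_measure_axioms\<close>)
    then show ?thesis using 2 by (simp add: sp count_cylinder_def)
  qed simp
qed

subsection \<open>Laplace functional of a Poisson process\<close>

lemma relatively_compact_subset:
  "relatively_compact B \<Longrightarrow> A \<subseteq> B \<Longrightarrow> relatively_compact A"
  unfolding relatively_compact_def
  by (metis closed_closure closure_mono compact_Int_closed inf.absorb_iff2)

lemma relatively_compact_UN: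
  assumes "finite I" "\<And>i. i \<in> I \<Longrightarrow> relatively_compact (A i)"
  shows "relatively_compact (\<Union>i\<in>I. A i)"
proof -
  have "closure (\<Union>i\<in>I. A i) = (\<Union>i\<in>I. closure (A i))"
    using assms(1) by (induction I rule: finite_induct) auto
  then show ?thesis
    using assms by (auto simp: relatively_compact_def intro!: compact_UN)
qed

text \<open>The \<open>B n\<close> are the level sets of the function. Poisson counts are
  independent on disjoint sets only, so overlapping sets have to be removed first. The level 0 is
  dropped, which keeps every \<open>B n\<close> inside the union of the \<open>A i\<close> and
  therefore relatively compact.\<close>

lemma step_function_disjoint:
  fixes t :: "'i \<Rightarrow> real" and A :: "'i \<Rightarrow> 'a::metric_space set"
  assumes "finite I" and A: "\<And>i. i \<in> I \<Longrightarrow> A i \<in> sets borel \<and> relatively_compact (A i) \<and> 0 < t i"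
  obtains r :: nat and v B where
    "disjoint_family_on B {..<r}"
    "\<And>n. n < r \<Longrightarrow> B n \<in> sets borel \<and> relatively_compact (B n) \<and> 0 < v n"
    "\<And>x. (\<Sum>i\<in>I. t i * indicator (A i) x) = (\<Sum>n<r. v n * indicator (B n) x)"
proof -
  define f where "f x = (\<Sum>i\<in>I. t i * indicator (A i) x)" for x
  have [measurable]: "f \<in> borel_measurable borel"
    unfolding f_def using A by (intro borel_measurable_sum borel_measurable_times borel_measurable_const borel_measurable_indicator) auto
  have f_nonneg: "0 \<le> f x" for x
    unfolding f_def using A by (intro sum_nonneg) (auto simp: less_imp_le)
  have "f x = sum t {i\<in>I. x \<in> A i}" for x
    unfolding f_def sum.inter_filter[OF assms(1)] by (intro sum.cong) auto
  then have "f ` UNIV \<subseteq> sum t ` Pow I" by auto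
  then have fin: "finite (f ` UNIV - {0})"
    using assms(1) finite_subset[of "f ` UNIV" "sum t ` Pow I"] by simp
  obtain g where g: "bij_betw g {0..<card (f ` UNIV - {0})} (f ` UNIV - {0})"
    using ex_bij_betw_nat_finite[OF fin] by blast
  define r where "r = card (f ` UNIV - {0})"
  have g: "bij_betw g {..<r} (f ` UNIV - {0})"
    using g by (simp add: r_def atLeast0LessThan)
  define B where "B n = f -` {g n}" for n
  show thesis
  proof (rule that[of B r g])
    show "disjoint_family_on B {..<r}"
      using g unfolding disjoint_family_on_def B_def bij_betw_def inj_on_def by auto
    fix n assume "n < r"
    then have gn: "g n \<in> f ` UNIV - {0}" using g by (auto simp: bij_betw_def)
    have "B n = f -` {g n} \<inter> space borel" by (simp add: B_def)
    also have "\<dots> \<in> sets borel" by measurable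
    finally have "B n \<in> sets borel" .
    moreover have "B n \<subseteq> (\<Union>i\<in>I. A i)"
    proof
      fix x assume "x \<in> B n"
      then have "f x \<noteq> 0" using gn by (auto simp: B_def)
      then obtain i where "i \<in> I" "t i * indicator (A i) x \<noteq> 0"
        unfolding f_def by (meson sum.not_neutral_contains_not_neutral)
      then show "x \<in> (\<Union>i\<in>I. A i)" by (auto simp: indicator_def split: if_splits)
    qed
    then have "relatively_compact (B n)"
      using relatively_compact_subset[OF relatively_compact_UN[where I = I and A = A]] assms by blast
    moreover have "0 < g n" using gn f_nonneg by (auto simp: less_le)
    ultimately show "B n \<in> sets borel \<and> relatively_compact (B n) \<and> 0 < g n" by simp
  next
    fix x
    have "(\<Sum>n<r. g n * indicator (B n) x) = (\<Sum>n<r. (\<lambda>w. if f x = w then w else 0) (g n))"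
      by (intro sum.cong) (auto simp: B_def indicator_def)
    also have "\<dots> = (\<Sum>w\<in>f ` UNIV - {0}. if f x = w then w else 0)"
      by (rule sum.reindex_bij_betw[OF g])
    also have "\<dots> = f x"
      using fin by (auto simp: sum.delta)
    finally show "(\<Sum>i\<in>I. t i * indicator (A i) x) = (\<Sum>n<r. g n * indicator (B n) x)"
      by (simp add: f_def)
  qed
qed

lemma nn_integral_step_config:
  assumes "\<phi> \<in> configurations" "finite I"
    and "\<And>i. i \<in> I \<Longrightarrow> A i \<in> sets borel \<and> relatively_compact (A i) \<and> 0 < t i"
  shows "(\<integral>\<^sup>+x. ennreal (\<Sum>i\<in>I. t i * indicator (A i) x) \<partial>\<phi>) = ennreal (\<Sum>i\<in>I. t i * measure \<phi> (A i))"
proof -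
  have s: "A i \<in> sets \<phi>" if "i \<in> I" for i
    using assms that by (simp add: sets_configuration)
  have "(\<integral>\<^sup>+x. ennreal (\<Sum>i\<in>I. t i * indicator (A i) x) \<partial>\<phi>)
      = (\<integral>\<^sup>+x. (\<Sum>i\<in>I. ennreal (t i) * indicator (A i) x) \<partial>\<phi>)"
    using assms(3) by (intro nn_integral_cong)
      (auto simp: sum_ennreal[symmetric] less_imp_le ennreal_mult ennreal_indicator intro!: sum.cong)
  also have "\<dots> = (\<Sum>i\<in>I. ennreal (t i) * emeasure \<phi> (A i))"
    using assms s by (subst nn_integral_sum) (auto simp: nn_integral_cmult_indicator borel_measurable_times_ennreal)
  also have "\<dots> = (\<Sum>i\<in>I. ennreal (t i * measure \<phi> (A i)))"
    using assms by (intro sum.cong)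
      (auto simp: point_count ennreal_mult less_imp_le ennreal_of_nat_eq_real_of_nat)
  also have "\<dots> = ennreal (\<Sum>i\<in>I. t i * measure \<phi> (A i))"
    using assms(3) by (intro sum_ennreal) (auto simp: less_imp_le)
  finally show ?thesis .
qed

text \<open>Both exponents are the integral of one and the same function with respect to the
  configuration, which does not depend on the representation.\<close>

lemma laplace_eq_of_step_function_eq:
  assumes "space P = configurations" "finite I" "finite J"
    and A: "\<And>i. i \<in> I \<Longrightarrow> A i \<in> sets borel \<and> relatively_compact (A i) \<and> 0 < t i"
    and B: "\<And>j. j \<in> J \<Longrightarrow> B j \<in> sets borel \<and> relatively_compact (B j) \<and> 0 < v j"
    and eq: "\<And>x. (\<Sum>i\<in>I. t i * indicator (A i) x) = (\<Sum>j\<in>J. v j * indicator (B j) x :: real)"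
  shows "laplace P I t A = laplace P J v B"
  unfolding laplace_def
proof (rule nn_integral_cong)
  fix \<phi> assume "\<phi> \<in> space P"
  then have \<phi>: "\<phi> \<in> configurations" using assms by simp
  have "ennreal (\<Sum>i\<in>I. t i * measure \<phi> (A i)) = ennreal (\<Sum>j\<in>J. v j * measure \<phi> (B j))"
    using nn_integral_step_config[where I = I and A = A and t = t, OF \<phi> assms(2) A]
      nn_integral_step_config[where I = J and A = B and t = v, OF \<phi> assms(3) B] eq by simp
  then have "(\<Sum>i\<in>I. t i * measure \<phi> (A i)) = (\<Sum>j\<in>J. v j * measure \<phi> (B j))"
    using A B by (subst (asm) ennreal_inj) (auto intro!: sum_nonneg simp: less_imp_le)
  then show "ennreal (exp (- (\<Sum>i\<in>I. t i * measure \<phi> (A i)))) = ennreal (exp (- (\<Sum>j\<in>J. v j * measure \<phi> (B j))))"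
    by simp
qed

lemma poisson_pgf_sums:
  fixes a z :: real
  shows "(\<lambda>n. z ^ n * (a ^ n / fact n * exp (- a))) sums exp (a * (z - 1))"
proof -
  have "(\<lambda>n. exp (- a) * ((a * z) ^ n /\<^sub>R fact n)) sums (exp (- a) * exp (a * z))"
    by (intro sums_mult exp_converges)
  then show ?thesis
    by (simp add: exp_add[symmetric] right_diff_distrib power_mult_distrib field_simps)
qed

lemma poisson_pgf_suminf:
  assumes "0 \<le> a" "0 \<le> z"
  shows "(\<Sum>n. ennreal (z ^ n) * ennreal (a ^ n / fact n * exp (- a))) = ennreal (exp (a * (z - 1)))"
proof -
  have "(\<Sum>n. ennreal (z ^ n * (a ^ n / fact n * exp (- a)))) = ennreal (exp (a * (z - 1)))"
    using assms by (intro suminf_ennreal_eq poisson_pgf_sums) auto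
  moreover have "ennreal (z ^ n * (a ^ n / fact n * exp (- a))) = ennreal (z ^ n) * ennreal (a ^ n / fact n * exp (- a))" for n
    using assms by (intro ennreal_mult) auto
  ultimately show ?thesis by simp
qed

text \<open>Independence on disjoint sets factors the functional, and each factor is the generating
  function of a Poisson count at \<open>exp (- v n)\<close>.\<close>

lemma laplace_poisson_process:
  fixes M :: "'a::metric_space measure" and B :: "nat \<Rightarrow> 'a set"
  assumes P: "poisson_process \<Omega> M \<Phi>"
    and B: "disjoint_family_on B {..<r}"
      "\<And>n. n < r \<Longrightarrow> B n \<in> sets borel \<and> relatively_compact (B n)"
  shows "laplace (law \<Omega> \<Phi>) {..<r} v B = ennreal (exp (\<Sum>n<r. measure M (B n) * (exp (- v n) - 1)))"
proof -
  interpret prob_space \<Omega> using P by (simp add: poisson_process_def point_process_def)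
  have \<Phi>[measurable]: "\<Phi> \<in> measurable \<Omega> config_space"
    using P by (simp add: poisson_process_def point_process_def)
  have conf: "\<Phi> \<omega> \<in> configurations" if "\<omega> \<in> space \<Omega>" for \<omega>
    using measurable_space[OF \<Phi> that] by (simp add: space_config_space)
  have mB: "(\<lambda>\<phi>. measure \<phi> (B n)) \<in> borel_measurable config_space" if "n < r" for n
    using B(2)[OF that] by (intro measurable_measure_config) auto
  have single: "(\<integral>\<^sup>+\<omega>. ennreal (exp (- v n * measure (\<Phi> \<omega>) (B n))) \<partial>\<Omega>)
      = ennreal (exp (measure M (B n) * (exp (- v n) - 1)))" if "n < r" for n
  proof -
    have Bn: "B n \<in> sets borel" "relatively_compact (B n)" using B(2)[OF that] by auto
    note measurable_point_count[OF Bn, measurable]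
    have "(\<integral>\<^sup>+\<omega>. ennreal (exp (- v n * measure (\<Phi> \<omega>) (B n))) \<partial>\<Omega>)
        = (\<integral>\<^sup>+\<omega>. (\<lambda>k \<omega>. ennreal (exp (- v n) ^ k)) (point_count (\<Phi> \<omega>) (B n)) \<omega> \<partial>\<Omega>)"
      by (intro nn_integral_cong) (simp add: point_count(2)[OF conf Bn] exp_of_nat_mult[symmetric] mult.commute)
    also have "\<dots> = (\<Sum>k. \<integral>\<^sup>+\<omega>. indicator {\<omega> \<in> space \<Omega>. point_count (\<Phi> \<omega>) (B n) = k} \<omega> * ennreal (exp (- v n) ^ k) \<partial>\<Omega>)"
      by (rule nn_integral_countable_split) measurable
    also have "\<dots> = (\<Sum>k. ennreal (exp (- v n) ^ k) * ennreal (measure M (B n) ^ k / fact k * exp (- measure M (B n))))"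
    proof (rule suminf_cong)
      fix k
      have "{\<omega> \<in> space \<Omega>. point_count (\<Phi> \<omega>) (B n) = k} = {\<omega> \<in> space \<Omega>. emeasure (\<Phi> \<omega>) (B n) = of_nat k}"
        using point_count(1)[OF conf Bn] by auto
      then have e: "emeasure \<Omega> {\<omega> \<in> space \<Omega>. point_count (\<Phi> \<omega>) (B n) = k}
          = ennreal (measure M (B n) ^ k / fact k * exp (- measure M (B n)))"
        using P Bn by (simp only: emeasure_eq_measure poisson_process_def)
      have "{\<omega> \<in> space \<Omega>. point_count (\<Phi> \<omega>) (B n) = k} \<in> sets \<Omega>" by measurable
      then have "(\<integral>\<^sup>+\<omega>. indicator {\<omega> \<in> space \<Omega>. point_count (\<Phi> \<omega>) (B n) = k} \<omega> * ennreal (exp (- v n) ^ k) \<partial>\<Omega>)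
          = emeasure \<Omega> {\<omega> \<in> space \<Omega>. point_count (\<Phi> \<omega>) (B n) = k} * ennreal (exp (- v n) ^ k)"
        by (subst nn_integral_multc) auto
      then show "(\<integral>\<^sup>+\<omega>. indicator {\<omega> \<in> space \<Omega>. point_count (\<Phi> \<omega>) (B n) = k} \<omega> * ennreal (exp (- v n) ^ k) \<partial>\<Omega>)
          = ennreal (exp (- v n) ^ k) * ennreal (measure M (B n) ^ k / fact k * exp (- measure M (B n)))"
        by (simp only: e mult.commute)
    qed
    also have "\<dots> = ennreal (exp (measure M (B n) * (exp (- v n) - 1)))"
      by (rule poisson_pgf_suminf) auto
    finally show ?thesis .
  qed
  have all: "\<forall>(A :: nat \<Rightarrow> 'a set) I. finite I \<longrightarrow> disjoint_family_on A I \<longrightarrow>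
      (\<forall>i\<in>I. A i \<in> sets borel \<and> relatively_compact (A i)) \<longrightarrow>
      indep_vars (\<lambda>_. borel) (\<lambda>i \<omega>. emeasure (\<Phi> \<omega>) (A i)) I"
    using P unfolding poisson_process_def by (elim conjE)
  have ind: "indep_vars (\<lambda>_. borel) (\<lambda>n \<omega>. emeasure (\<Phi> \<omega>) (B n)) {..<r}"
    using all[THEN spec, of B, THEN spec, of "{..<r}"] B by simp
  have ind': "indep_vars (\<lambda>_. borel) (\<lambda>n \<omega>. ennreal (exp (- v n * measure (\<Phi> \<omega>) (B n)))) {..<r}"
    unfolding measure_def
    by (rule indep_vars_compose2[OF ind, where Y = "\<lambda>n y. ennreal (exp (- v n * enn2real y))"]) measurable
  have "laplace (law \<Omega> \<Phi>) {..<r} v B = (\<integral>\<^sup>+\<omega>. ennreal (exp (- (\<Sum>n<r. v n * measure (\<Phi> \<omega>) (B n)))) \<partial>\<Omega>)"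
    unfolding laplace_def
  proof (subst nn_integral_distr[OF \<Phi>])
    have "(\<lambda>\<phi>. \<Sum>n<r. v n * measure \<phi> (B n)) \<in> borel_measurable config_space"
      by (intro borel_measurable_sum borel_measurable_times borel_measurable_const mB) simp
    then show "(\<lambda>\<phi>. ennreal (exp (- (\<Sum>n<r. v n * measure \<phi> (B n))))) \<in> borel_measurable (law \<Omega> \<Phi>)"
      by measurable
  qed simp
  also have "\<dots> = (\<integral>\<^sup>+\<omega>. (\<Prod>n<r. ennreal (exp (- v n * measure (\<Phi> \<omega>) (B n)))) \<partial>\<Omega>)"
    by (simp add: prod_ennreal exp_sum[symmetric] sum_negf)
  also have "\<dots> = (\<Prod>n<r. \<integral>\<^sup>+\<omega>. ennreal (exp (- v n * measure (\<Phi> \<omega>) (B n))) \<partial>\<Omega>)"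
    by (rule indep_vars_nn_integral[OF _ ind']) auto
  also have "\<dots> = (\<Prod>n<r. ennreal (exp (measure M (B n) * (exp (- v n) - 1))))"
    by (intro prod.cong refl single) simp
  also have "\<dots> = ennreal (exp (\<Sum>n<r. measure M (B n) * (exp (- v n) - 1)))"
    by (simp add: prod_ennreal exp_sum)
  finally show ?thesis .
qed

subsection \<open>Law of the conditional process\<close>

text \<open>Applied to complements the inequality reverses, since both total masses are 1. A lower
  bound on the law of the conditional process is then enough, without treating the event that
  \<open>C\<close> is never visited.\<close>

lemma prob_space_eqI_le:
  assumes "prob_space M" "prob_space N" and s: "sets M = sets N"
    and le: "\<And>A. A \<in> sets M \<Longrightarrow> emeasure N A \<le> emeasure M A"
  shows "M = N"
proof (rule measure_eqI[OF s])
  interpret M: prob_space M by fact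
  interpret N: prob_space N by fact
  fix A assume A: "A \<in> sets M"
  have sp: "space M = space N" using s by (rule sets_eq_imp_space_eq)
  have "space N - A \<in> sets M" using A s by auto
  then have "N.prob A \<le> M.prob A" "N.prob (space N - A) \<le> M.prob (space N - A)"
    using le[OF A] le[of "space N - A"]
    by (simp_all add: M.emeasure_eq_measure N.emeasure_eq_measure)
  then show "emeasure M A = emeasure N A"
    using A s M.prob_compl[of A] N.prob_compl[of A]
    by (simp add: M.emeasure_eq_measure N.emeasure_eq_measure sp)
qed

lemma measurable_conditional_process:
  assumes \<Psi>: "\<And>n. \<Psi> n \<in> measurable \<Omega> config_space" and C: "C \<in> sets config_space"
  shows "conditional_process C \<Psi> \<in> measurable \<Omega> config_space"
proof -
  have null: "null_measure borel \<in> configurations"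
    by (auto simp: configurations_def)
  note \<Psi>[measurable] C[measurable]
  have [measurable]: "(\<lambda>\<omega>. \<Psi> (LEAST n. \<Psi> n \<omega> \<in> C) \<omega>) \<in> measurable \<Omega> config_space"
    by (rule measurable_compose_countable[where f = "\<lambda>n \<omega>. \<Psi> n \<omega>"]) measurable
  have "(\<lambda>\<omega>. null_measure borel) \<in> measurable \<Omega> config_space"
    using null by (intro measurable_const) (simp add: space_config_space)
  then show ?thesis
    unfolding conditional_process_def[abs_def] by measurable
qed

text \<open>The first visit to \<open>C\<close> occurs at index \<open>n\<close> and inside
  \<open>A\<close> with probability \<open>q ^ n * measure P (C \<inter> A)\<close>; the geometric
  series over \<open>n\<close> gives division by the probability of \<open>C\<close>.\<close>

lemma law_conditional_process:
  assumes I: "independent_copies \<Omega> \<Psi> P" and C: "C \<in> sets config_space" and pos: "emeasure P C \<noteq> 0"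
  shows "law \<Omega> (conditional_process C \<Psi>) = uniform_measure P C"
proof -
  have \<Psi>[measurable]: "\<Psi> n \<in> measurable \<Omega> config_space" for n
    using I by (simp add: independent_copies_def point_process_def)
  have P: "P = law \<Omega> (\<Psi> n)" for n
    using I by (simp add: independent_copies_def)
  interpret prob_space \<Omega>
    using I by (simp add: independent_copies_def point_process_def)
  interpret P: prob_space P
    unfolding P[of 0] by (rule prob_space_distr) simp
  have sP: "sets P = sets config_space" using P[of 0] by simp
  have spP: "space P = space config_space" using P[of 0] by simp
  note C[measurable]
  have CP: "C \<in> sets P" using C sP by simp
  note mC = measurable_conditional_process[OF \<Psi> C]
  have ind: "indep_vars (\<lambda>_. config_space) \<Psi> UNIV"
    using I by (simp add: independent_copies_def)
  have prob_\<Psi>: "prob (\<Psi> n -` A \<inter> space \<Omega>) = measure P A" if "A \<in> sets config_space" for A n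
    unfolding P[of n] using that by (simp add: measure_distr)
  define q where "q = 1 - measure P C"
  have p_pos: "0 < measure P C"
    using pos P.emeasure_eq_measure[of C] by (simp add: zero_less_measure_iff)
  have q: "0 \<le> q" "q < 1" using p_pos by (simp_all add: q_def)
  show ?thesis
  proof (rule prob_space_eqI_le)
    show "prob_space (law \<Omega> (conditional_process C \<Psi>))"
      using mC by (rule prob_space_distr)
    show "prob_space (uniform_measure P C)"
      using pos by (intro prob_space_uniform_measure) simp_all
    show "sets (law \<Omega> (conditional_process C \<Psi>)) = sets (uniform_measure P C)"
      by (simp add: sP)
    fix A assume "A \<in> sets (law \<Omega> (conditional_process C \<Psi>))"
    then have A[measurable]: "A \<in> sets config_space" by simp
    \<comment> \<open>This form, with one event per index up to \<open>n\<close>, is the one to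
      which the product rule for independent variables applies.\<close>
    define E where "E n = (\<Inter>i\<in>{..n}. \<Psi> i -` (if i = n then C \<inter> A else space config_space - C) \<inter> space \<Omega>)" for n
    have E_eq: "E n = {\<omega> \<in> space \<Omega>. (\<forall>i<n. \<Psi> i \<omega> \<notin> C) \<and> \<Psi> n \<omega> \<in> C \<and> \<Psi> n \<omega> \<in> A}" for n
    proof -
      have "\<Psi> i \<omega> \<in> space config_space" if "\<omega> \<in> space \<Omega>" for i \<omega>
        using that by (rule measurable_space[OF \<Psi>])
      then show ?thesis unfolding E_def by (auto simp: less_le split: if_splits)
    qed
    have mE: "E n \<in> sets \<Omega>" for n
      unfolding E_eq by measurable
    have "prob (E n) = (\<Prod>i\<in>{..n}. prob (\<Psi> i -` (if i = n then C \<inter> A else space config_space - C) \<inter> space \<Omega>))" for n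
      unfolding E_def using ind by (rule indep_varsD) auto
    also have "(\<Prod>i\<in>{..n}. prob (\<Psi> i -` (if i = n then C \<inter> A else space config_space - C) \<inter> space \<Omega>))
        = q ^ n * measure P (C \<inter> A)" for n
    proof -
      have "(\<Prod>i\<in>{..n}. prob (\<Psi> i -` (if i = n then C \<inter> A else space config_space - C) \<inter> space \<Omega>))
          = (\<Prod>i\<in>{..<n}. prob (\<Psi> i -` (if i = n then C \<inter> A else space config_space - C) \<inter> space \<Omega>))
            * prob (\<Psi> n -` (C \<inter> A) \<inter> space \<Omega>)"
        unfolding lessThan_Suc_atMost[symmetric] by simp
      also have "(\<Prod>i\<in>{..<n}. prob (\<Psi> i -` (if i = n then C \<inter> A else space config_space - C) \<inter> space \<Omega>)) = (\<Prod>i\<in>{..<n}. q)"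
        using P.prob_compl[OF CP] by (intro prod.cong) (auto simp: prob_\<Psi> q_def spP)
      also have "prob (\<Psi> n -` (C \<inter> A) \<inter> space \<Omega>) = measure P (C \<inter> A)"
        by (rule prob_\<Psi>) measurable
      finally show ?thesis by (simp only: prod_constant card_lessThan)
    qed
    finally have pE: "emeasure \<Omega> (E n) = ennreal (q ^ n * measure P (C \<inter> A))" for n
      by (simp add: emeasure_eq_measure)
    have dE: "disjoint_family E"
    proof -
      have "E i \<inter> E j = {}" if "i < j" for i j
        using that by (auto simp: E_eq)
      then show ?thesis
        unfolding disjoint_family_on_def by (metis Int_commute nat_neq_iff)
    qed
    have "emeasure (uniform_measure P C) A = emeasure P (C \<inter> A) / emeasure P C"
      using CP A sP by (intro emeasure_uniform_measure) auto
    also have "\<dots> = ennreal (measure P (C \<inter> A) / (1 - q))"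
      using p_pos by (simp add: P.emeasure_eq_measure divide_ennreal q_def)
    also have "\<dots> = (\<Sum>n. ennreal (q ^ n * measure P (C \<inter> A)))"
    proof -
      have "(\<lambda>n. q ^ n * measure P (C \<inter> A)) sums (1 / (1 - q) * measure P (C \<inter> A))"
        using q by (intro sums_mult2 geometric_sums) simp
      then show ?thesis using q by (subst suminf_ennreal_eq) auto
    qed
    also have "\<dots> = emeasure \<Omega> (\<Union>n. E n)"
      unfolding pE[symmetric] using mE dE by (intro suminf_emeasure) auto
    also have "\<dots> \<le> emeasure \<Omega> (conditional_process C \<Psi> -` A \<inter> space \<Omega>)"
    proof (rule emeasure_mono)
      show "conditional_process C \<Psi> -` A \<inter> space \<Omega> \<in> sets \<Omega>"
        using mC A by (rule measurable_sets)
      show "(\<Union>n. E n) \<subseteq> conditional_process C \<Psi> -` A \<inter> space \<Omega>"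
      proof
        fix \<omega> assume "\<omega> \<in> (\<Union>n. E n)"
        then obtain n where n: "\<omega> \<in> space \<Omega>" "\<forall>i<n. \<Psi> i \<omega> \<notin> C" "\<Psi> n \<omega> \<in> C" "\<Psi> n \<omega> \<in> A"
          by (auto simp: E_eq)
        then have "(LEAST n. \<Psi> n \<omega> \<in> C) = n"
          by (intro Least_equality) (auto simp: not_less[symmetric])
        then show "\<omega> \<in> conditional_process C \<Psi> -` A \<inter> space \<Omega>"
          using n by (auto simp: conditional_process_def)
      qed
    qed
    also have "\<dots> = emeasure (law \<Omega> (conditional_process C \<Psi>)) A"
      using mC by (simp add: emeasure_distr)
    finally show "emeasure (uniform_measure P C) A \<le> emeasure (law \<Omega> (conditional_process C \<Psi>)) A" .
  qed
qed

subsection \<open>The Poisson process as a superposition of independent slots\<close>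

definition poisson_count :: "real \<Rightarrow> nat measure" where
  "poisson_count \<mu> = density (count_space UNIV) (\<lambda>n. ennreal (\<mu> ^ n / fact n * exp (- \<mu>)))"

lemma sets_poisson_count [measurable_cong]: "sets (poisson_count \<mu>) = sets (count_space UNIV)"
  by (simp add: poisson_count_def)

lemma nn_integral_poisson_count:
  "(\<integral>\<^sup>+n. f n \<partial>poisson_count \<mu>) = (\<Sum>n. ennreal (\<mu> ^ n / fact n * exp (- \<mu>)) * f n)"
  unfolding poisson_count_def
  by (subst nn_integral_density) (auto simp: nn_integral_count_space_nat)

lemma prob_space_poisson_count:
  assumes "0 \<le> \<mu>"
  shows "prob_space (poisson_count \<mu>)"
proof (rule prob_spaceI)
  have "emeasure (poisson_count \<mu>) (space (poisson_count \<mu>)) = (\<integral>\<^sup>+n. 1 \<partial>poisson_count \<mu>)"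
    by simp
  also have "\<dots> = 1"
    unfolding nn_integral_poisson_count using poisson_pgf_suminf[OF assms zero_le_one] by simp
  finally show "emeasure (poisson_count \<mu>) (space (poisson_count \<mu>)) = 1" .
qed

text \<open>In the application \<open>D\<close> is the normalised intensity and \<open>\<mu>\<close>
  its total mass divided by \<open>k\<close>.\<close>

locale poisson_slots =
  fixes D :: "'a::metric_space measure" and \<mu> :: real and k :: nat
  assumes prob_D: "prob_space D" and sets_D [measurable_cong]: "sets D = sets borel" and \<mu>_nonneg: "0 \<le> \<mu>"
begin

text \<open>Infinitely many points are drawn and only the first \<open>fst s\<close> are read. The
  law of a slot is then a product measure, and no mixture over the number of points is
  needed.\<close>

definition S :: "(nat \<times> (nat \<Rightarrow> 'a)) measure" where
  "S = poisson_count \<mu> \<Otimes>\<^sub>M PiM UNIV (\<lambda>_. D)"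

definition Q :: "(nat \<Rightarrow> nat \<times> (nat \<Rightarrow> 'a)) measure" where
  "Q = PiM {..<k} (\<lambda>_. S)"

sublocale D: prob_space D by (rule prob_D)
sublocale N: prob_space "poisson_count \<mu>" by (rule prob_space_poisson_count[OF \<mu>_nonneg])
sublocale X: product_prob_space "\<lambda>_ :: nat. D" UNIV
  by unfold_locales
sublocale NX: pair_prob_space "poisson_count \<mu>" "PiM UNIV (\<lambda>_ :: nat. D)"
  by unfold_locales
sublocale S: prob_space S
  unfolding S_def by unfold_locales
sublocale SP: product_prob_space "\<lambda>_ :: nat. S" "{..<k}"
  by unfold_locales
sublocale Q: prob_space Q
  unfolding Q_def by unfold_locales

lemma measurable_fst_S [measurable]: "fst \<in> measurable S (count_space UNIV)"
  unfolding S_def by measurable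

lemma measurable_snd_S [measurable]: "(\<lambda>s. snd s j) \<in> measurable S borel"
  unfolding S_def by measurable

lemma measurable_slot_prod:
  fixes h :: "'a \<Rightarrow> ennreal"
  assumes [measurable]: "h \<in> borel_measurable borel"
  shows "(\<lambda>s. \<Prod>j<fst s. h (snd s j)) \<in> borel_measurable S"
  by (rule measurable_compose_countable[where f = "\<lambda>n s. \<Prod>j<n. h (snd s j)" and g = fst]) measurable

lemma measurable_slot_count:
  assumes [measurable]: "A \<in> sets borel"
  shows "(\<lambda>s. of_nat (slot_count s A) :: ennreal) \<in> borel_measurable S"
proof -
  have "(\<lambda>s. \<Sum>j<fst s. indicator A (snd s j) :: ennreal) \<in> borel_measurable S"
    by (rule measurable_compose_countable[where f = "\<lambda>n s. \<Sum>j<n. indicator A (snd s j)" and g = fst]) measurable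
  moreover have "of_nat (slot_count s A) = (\<Sum>j<fst s. indicator A (snd s j) :: ennreal)" for s
    unfolding slot_count_eq_sum of_nat_sum by (intro sum.cong) auto
  ultimately show ?thesis by simp
qed

lemma measurable_superpose [measurable]: "superpose k \<in> measurable Q config_space"
proof (rule measurable_config_spaceI)
  fix A :: "'a set" assume A: "A \<in> sets borel"
  have "(\<lambda>y. \<Sum>i<k. of_nat (slot_count (y i) A) :: ennreal) \<in> borel_measurable Q"
    unfolding Q_def
  proof (rule borel_measurable_sum)
    fix i assume "i \<in> {..<k}"
    then show "(\<lambda>y. of_nat (slot_count (y i) A) :: ennreal) \<in> borel_measurable (PiM {..<k} (\<lambda>_. S))"
      by (intro measurable_compose[OF measurable_component_singleton[of i "{..<k}" "\<lambda>_. S"] measurable_slot_count[OF A]])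
  qed
  then show "(\<lambda>y. emeasure (superpose k y) A) \<in> borel_measurable Q"
    by (simp add: emeasure_superpose A)
qed (rule superpose_in_configurations)

lemma nn_integral_sample_prod:
  fixes h :: "'a \<Rightarrow> ennreal"
  assumes [measurable]: "h \<in> borel_measurable borel"
  shows "(\<integral>\<^sup>+x. (\<Prod>j<n. h (x j)) \<partial>PiM UNIV (\<lambda>_. D)) = (\<integral>\<^sup>+x. h x \<partial>D) ^ n"
proof -
  have "(\<integral>\<^sup>+x. (\<Prod>j<n. h (x j)) \<partial>PiM UNIV (\<lambda>_. D))
      = (\<integral>\<^sup>+x. (\<Prod>j<n. h (restrict x {..<n} j)) \<partial>PiM UNIV (\<lambda>_. D))"
    by simp
  also have "\<dots> = (\<integral>\<^sup>+x. (\<Prod>j<n. h (x j)) \<partial>distr (PiM UNIV (\<lambda>_. D)) (PiM {..<n} (\<lambda>_. D)) (\<lambda>x. restrict x {..<n}))"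
    by (subst nn_integral_distr) (auto intro!: measurable_restrict_subset)
  also have "\<dots> = (\<integral>\<^sup>+x. (\<Prod>j<n. h (x j)) \<partial>PiM {..<n} (\<lambda>_. D))"
    by (subst X.distr_PiM_restrict_finite) auto
  also have "\<dots> = (\<integral>\<^sup>+x. h x \<partial>D) ^ n"
    by (subst X.product_nn_integral_prod) auto
  finally show ?thesis .
qed

lemma nn_integral_S:
  assumes "f \<in> borel_measurable S"
  shows "(\<integral>\<^sup>+s. f s \<partial>S) = (\<Sum>n. ennreal (\<mu> ^ n / fact n * exp (- \<mu>)) * (\<integral>\<^sup>+x. f (n, x) \<partial>PiM UNIV (\<lambda>_. D)))"
  using assms unfolding S_def
  by (subst X.nn_integral_fst[symmetric]) (auto simp: nn_integral_poisson_count)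

text \<open>Given \<open>n\<close> points the product has mean \<open>a ^ n\<close>, so the Poisson
  generating function is evaluated at \<open>a\<close>.\<close>

lemma nn_integral_slot_prod:
  fixes h :: "'a \<Rightarrow> ennreal"
  assumes h: "h \<in> borel_measurable borel" and a: "(\<integral>\<^sup>+x. h x \<partial>D) = ennreal a" "0 \<le> a"
  shows "(\<integral>\<^sup>+s. (\<Prod>j<fst s. h (snd s j)) \<partial>S) = ennreal (exp (\<mu> * (a - 1)))"
  using nn_integral_sample_prod[OF h] a poisson_pgf_suminf[OF \<mu>_nonneg a(2)]
  by (subst nn_integral_S[OF measurable_slot_prod[OF h]]) (simp add: ennreal_power mult.commute)

text \<open>The exponential of minus the step function is multiplicative over points, so each slot
  contributes \<open>exp (\<mu> * (a - 1))\<close>, where \<open>a\<close> is the mean of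
  \<open>h\<close> under \<open>D\<close>, and the \<open>k\<close> independent slots give the power
  \<open>k\<close>.\<close>

lemma laplace_superpose:
  fixes r :: nat
  assumes B: "disjoint_family_on B {..<r}" "\<And>n. n < r \<Longrightarrow> B n \<in> sets borel"
    and v: "\<And>n. n < r \<Longrightarrow> 0 < v n"
    and rc: "\<And>n. n < r \<Longrightarrow> relatively_compact (B n)"
  shows "laplace (distr Q config_space (superpose k)) {..<r} v B
    = ennreal (exp (\<Sum>n<r. real k * \<mu> * measure D (B n) * (exp (- v n) - 1)))"
proof -
  define h where "h x = exp (- (\<Sum>n<r. v n * indicator (B n) x))" for x
  \<comment> \<open>A point lies in at most one \<open>B n\<close>; this makes \<open>a - 1\<close>
    linear in the masses of the \<open>B n\<close>, as in the Poisson functional.\<close>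
  have h_sum: "h x = 1 + (\<Sum>n<r. indicator (B n) x * (exp (- v n) - 1))" for x
  proof (cases "\<exists>m<r. x \<in> B m")
    case True
    then obtain m where m: "m < r" "x \<in> B m" by blast
    have ind: "(indicator (B n) x :: real) = (if n = m then 1 else 0)" if "n < r" for n
      using B(1) m that by (auto simp: disjoint_family_on_def indicator_def)
    have "(\<Sum>n<r. v n * indicator (B n) x) = (\<Sum>n<r. if n = m then v n else 0)"
      "(\<Sum>n<r. indicator (B n) x * (exp (- v n) - 1)) = (\<Sum>n<r. if n = m then exp (- v n) - 1 else 0)"
      by (intro sum.cong refl, simp add: ind)+
    then show ?thesis using m by (simp add: h_def)
  next
    case False
    then show ?thesis by (simp add: h_def)
  qed
  have mB[measurable]: "n < r \<Longrightarrow> B n \<in> sets D" for n using B(2) sets_D by simp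
  have int: "integrable D (\<lambda>x. indicator (B n) x * (exp (- v n) - 1) :: real)" if "n < r" for n
    using mB[OF that] by (intro integrable_mult_left) (auto simp: D.emeasure_eq_measure)
  have intS: "integrable D (\<lambda>x. \<Sum>n<r. indicator (B n) x * (exp (- v n) - 1) :: real)"
    using int by (intro Bochner_Integration.integrable_sum) auto
  define a where "a = 1 + (\<Sum>n<r. measure D (B n) * (exp (- v n) - 1))"
  have inth: "integrable D h"
    unfolding h_sum using intS by (intro Bochner_Integration.integrable_add) auto
  have "integral\<^sup>L D h = 1 + integral\<^sup>L D (\<lambda>x. \<Sum>n<r. indicator (B n) x * (exp (- v n) - 1))"
    unfolding h_sum using intS
    by (subst Bochner_Integration.integral_add) (simp_all only: D.integrable_const lebesgue_integral_const D.prob_space scaleR_one)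
  also have "integral\<^sup>L D (\<lambda>x. \<Sum>n<r. indicator (B n) x * (exp (- v n) - 1))
      = (\<Sum>n<r. integral\<^sup>L D (\<lambda>x. indicator (B n) x * (exp (- v n) - 1)))"
    by (rule Bochner_Integration.integral_sum) (use int in auto)
  also have "\<dots> = (\<Sum>n<r. measure D (B n) * (exp (- v n) - 1))"
    using mB by (intro sum.cong) simp_all
  also have "1 + \<dots> = a"
    by (simp add: a_def)
  finally have ah: "integral\<^sup>L D h = a" .
  have a0: "0 \<le> a" unfolding ah[symmetric] by (intro integral_nonneg_AE) (simp add: h_def)
  have nnh: "(\<integral>\<^sup>+x. ennreal (h x) \<partial>D) = ennreal a"
    using inth ah by (subst nn_integral_eq_integral) (auto simp: h_def)
  have hm: "(\<lambda>x. ennreal (h x)) \<in> borel_measurable borel"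
    using borel_measurable_integrable[OF inth] sets_D by (simp cong: measurable_cong_sets)
  have slot: "ennreal (exp (- (\<Sum>n<r. v n * real (slot_count s (B n))))) = (\<Prod>j<fst s. ennreal (h (snd s j)))" for s
  proof -
    have "(\<Sum>n<r. v n * real (slot_count s (B n))) = (\<Sum>n<r. \<Sum>j<fst s. v n * indicator (B n) (snd s j))"
      unfolding slot_count_eq_sum of_nat_sum sum_distrib_left by (intro sum.cong) auto
    also have "\<dots> = (\<Sum>j<fst s. \<Sum>n<r. v n * indicator (B n) (snd s j))"
      by (rule sum.swap)
    finally show ?thesis
      by (simp add: prod_ennreal h_def exp_sum[symmetric] sum_negf)
  qed
  have "laplace (distr Q config_space (superpose k)) {..<r} v B
      = (\<integral>\<^sup>+y. ennreal (exp (- (\<Sum>n<r. v n * measure (superpose k y) (B n)))) \<partial>Q)"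
    unfolding laplace_def
  proof (subst nn_integral_distr[OF measurable_superpose])
    have "(\<lambda>\<phi>. \<Sum>n<r. v n * measure \<phi> (B n)) \<in> borel_measurable config_space"
      using B(2) rc by (intro borel_measurable_sum borel_measurable_times borel_measurable_const measurable_measure_config) auto
    then show "(\<lambda>\<phi>. ennreal (exp (- (\<Sum>n<r. v n * measure \<phi> (B n))))) \<in> borel_measurable (distr Q config_space (superpose k))"
      by measurable
  qed simp
  also have "\<dots> = (\<integral>\<^sup>+y. (\<Prod>i<k. \<Prod>j<fst (y i). ennreal (h (snd (y i) j))) \<partial>Q)"
  proof (rule nn_integral_cong)
    fix y
    have "(\<Sum>n<r. v n * measure (superpose k y) (B n)) = (\<Sum>n<r. \<Sum>i<k. v n * real (slot_count (y i) (B n)))"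
      using B(2) by (intro sum.cong) (simp_all add: measure_superpose sum_distrib_left)
    also have "\<dots> = (\<Sum>i<k. \<Sum>n<r. v n * real (slot_count (y i) (B n)))"
      by (rule sum.swap)
    finally have "ennreal (exp (- (\<Sum>n<r. v n * measure (superpose k y) (B n))))
        = (\<Prod>i<k. ennreal (exp (- (\<Sum>n<r. v n * real (slot_count (y i) (B n))))))"
      by (simp add: prod_ennreal exp_sum[symmetric] sum_negf)
    then show "ennreal (exp (- (\<Sum>n<r. v n * measure (superpose k y) (B n)))) = (\<Prod>i<k. \<Prod>j<fst (y i). ennreal (h (snd (y i) j)))"
      by (simp only: slot)
  qed
  also have "\<dots> = (\<Prod>i<k. \<integral>\<^sup>+s. (\<Prod>j<fst s. ennreal (h (snd s j))) \<partial>S)"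
    unfolding Q_def by (rule SP.product_nn_integral_prod) (auto intro: measurable_slot_prod hm)
  also have "\<dots> = ennreal (exp (\<mu> * (a - 1))) ^ k"
    by (simp add: nn_integral_slot_prod[OF hm nnh a0])
  also have "\<dots> = ennreal (exp (real k * (\<mu> * (a - 1))))"
    by (simp add: ennreal_power exp_of_nat_mult)
  also have "real k * (\<mu> * (a - 1)) = (\<Sum>n<r. real k * \<mu> * measure D (B n) * (exp (- v n) - 1))"
    by (simp add: a_def sum_distrib_left mult_ac)
  finally show ?thesis .
qed

text \<open>A general step function is rewritten over disjoint sets, where both Laplace functionals
  are explicit and agree because \<open>k * \<mu> * D\<close> is the intensity.\<close>

lemma law_superpose:
  assumes P: "poisson_process \<Omega> M \<Phi>"
    and M: "\<And>A. A \<in> sets borel \<Longrightarrow> measure M A = real k * \<mu> * measure D A"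
  shows "distr Q config_space (superpose k) = law \<Omega> \<Phi>"
proof (rule config_law_eqI)
  have \<Phi>: "prob_space \<Omega>" "\<Phi> \<in> measurable \<Omega> config_space"
    using P by (simp_all add: poisson_process_def point_process_def)
  show "prob_space (distr Q config_space (superpose k))" by (rule Q.prob_space_distr) simp
  show "prob_space (law \<Omega> \<Phi>)" using \<Phi> by (rule prob_space.prob_space_distr)
  fix I :: "'a set set" and t :: "'a set \<Rightarrow> real"
  assume I: "finite I" "\<forall>A\<in>I. A \<in> sets borel \<and> relatively_compact A \<and> 0 < t A"
  obtain r :: nat and v B where B: "disjoint_family_on B {..<r}"
    "\<And>n. n < r \<Longrightarrow> B n \<in> sets borel \<and> relatively_compact (B n) \<and> 0 < v n"
    "\<And>x. (\<Sum>A\<in>I. t A * indicator A x) = (\<Sum>n<r. v n * indicator (B n) x)"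
  proof (rule step_function_disjoint[where I = I and A = "\<lambda>A. A" and t = t])
    show "finite I" by fact
    show "A \<in> sets borel \<and> relatively_compact A \<and> 0 < t A" if "A \<in> I" for A
      using I that by blast
  qed (rule that; assumption)
  have *: "laplace R I t (\<lambda>A. A) = laplace R {..<r} v B" if "space R = configurations" for R
    by (rule laplace_eq_of_step_function_eq[OF that]) (use I B in auto)
  have "laplace (distr Q config_space (superpose k)) {..<r} v B = laplace (law \<Omega> \<Phi>) {..<r} v B"
    using B M by (simp add: laplace_superpose laplace_poisson_process[OF P])
  then show "laplace (distr Q config_space (superpose k)) I t (\<lambda>A. A) = laplace (law \<Omega> \<Phi>) I t (\<lambda>A. A)"
    by (simp add: * space_config_space)
qed simp_all

end

subsection \<open>The Metropolis sweep\<close>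

text \<open>The target law has a density with respect to the product law that is constant on the
  admissible vectors, and the proposal redraws slot \<open>i\<close> from its unconditioned law; the
  Metropolis acceptance probability therefore reduces to 0 or 1.\<close>

definition metropolis_step ::
  "'a::metric_space measure set \<Rightarrow> nat \<Rightarrow> nat \<Rightarrow> (nat \<Rightarrow> nat \<times> (nat \<Rightarrow> 'a)) \<Rightarrow> nat \<times> (nat \<Rightarrow> 'a)
    \<Rightarrow> nat \<Rightarrow> nat \<times> (nat \<Rightarrow> 'a)" where
  "metropolis_step C k i y s = (if superpose k (y(i := s)) \<in> C then y(i := s) else y)"

primrec sweep ::
  "'a::metric_space measure set \<Rightarrow> nat \<Rightarrow> nat \<Rightarrow> (nat \<Rightarrow> nat \<times> (nat \<Rightarrow> 'a)) \<Rightarrow> (nat \<Rightarrow> nat \<times> (nat \<Rightarrow> 'a))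
    \<Rightarrow> nat \<Rightarrow> nat \<times> (nat \<Rightarrow> 'a)" where
  "sweep C k 0 y \<xi> = y"
| "sweep C k (Suc i) y \<xi> = metropolis_step C k i (sweep C k i y \<xi>) (\<xi> i)"

text \<open>The first \<open>i\<close> steps read only the first \<open>i\<close> entries of
  \<open>\<xi>\<close>. Hence \<open>\<xi> i\<close> is still fresh when step \<open>i\<close>
  begins.\<close>

lemma sweep_cong: "(\<And>j. j < i \<Longrightarrow> \<xi> j = \<xi>' j) \<Longrightarrow> sweep C k i y \<xi> = sweep C k i y \<xi>'"
  by (induction i) auto

text \<open>Slot \<open>j\<close> changes at step \<open>j\<close> or never, so its final content is
  decided by the acceptance test made in the state before that step.\<close>

lemma sweep_coordinate:
  "sweep C k i y \<xi> j =
    (if j < i \<and> superpose k ((sweep C k j y \<xi>)(j := \<xi> j)) \<in> C then \<xi> j else y j)"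
proof (induction i)
  case (Suc i)
  then show ?case by (cases "j = i") (auto simp: metropolis_step_def fun_upd_def)
qed simp

text \<open>The sum of the two numbers of points bounds the discrepancy of the two slots on every
  set. A function of the total number is convenient for the comparison with factorial
  moments.\<close>

definition rejection_cost ::
  "'a::metric_space measure set \<Rightarrow> nat \<Rightarrow> nat \<Rightarrow> (nat \<Rightarrow> nat \<times> (nat \<Rightarrow> 'a)) \<Rightarrow> nat \<times> (nat \<Rightarrow> 'a) \<Rightarrow> nat" where
  "rejection_cost C k j y s = (if superpose k (y(j := s)) \<in> C then 0 else fst (y j) + fst s)"

text \<open>An accepted slot coincides with that of \<open>\<xi>\<close>, so only rejected slots
  contribute.\<close>

lemma tv_dist_sweep_le:
  "tv_dist (superpose k (sweep C k k y \<xi>)) (superpose k \<xi>)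
    \<le> of_nat (\<Sum>j<k. rejection_cost C k j (sweep C k j y \<xi>) (\<xi> j))"
proof (rule tv_dist_superpose_le)
  fix A
  show "(\<Sum>i<k. \<bar>real (slot_count (sweep C k k y \<xi> i) A) - real (slot_count (\<xi> i) A)\<bar>)
      \<le> real (\<Sum>j<k. rejection_cost C k j (sweep C k j y \<xi>) (\<xi> j))"
    unfolding of_nat_sum
  proof (rule sum_mono)
    fix j assume "j \<in> {..<k}"
    \<comment> \<open>The cost is evaluated in the state before step \<open>j\<close>, where slot
      \<open>j\<close> still holds its initial content.\<close>
    moreover have "sweep C k j y \<xi> j = y j" by (simp add: sweep_coordinate)
    moreover have "\<bar>real (slot_count (y j) A) - real (slot_count (\<xi> j) A)\<bar> \<le> real (fst (y j)) + real (fst (\<xi> j))"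
      using slot_count_le[of "y j" A] slot_count_le[of "\<xi> j" A] by linarith
    ultimately show "\<bar>real (slot_count (sweep C k k y \<xi> j) A) - real (slot_count (\<xi> j) A)\<bar>
        \<le> real (rejection_cost C k j (sweep C k j y \<xi>) (\<xi> j))"
      by (simp add: sweep_coordinate[of C k k] rejection_cost_def)
  qed
qed

section \<open>Exchangeability of an old and a redrawn slot\<close>

context poisson_slots
begin

lemma measurable_update_slot:
  assumes "i < k"
  shows "(\<lambda>p. (fst p)(i := snd p)) \<in> measurable (Q \<Otimes>\<^sub>M S) Q"
  using measurable_add_dim[of i "{..<k}" "\<lambda>_. S"] assms
  by (simp add: Q_def insert_absorb case_prod_beta')

text \<open>The old slot \<open>y i\<close> and the new slot \<open>s\<close> are independent,
  equally distributed and independent of the other slots. This symmetry gives detailed balance for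
  the Metropolis step and later turns deletions into additions.\<close>

lemma nn_integral_update_slot_swap:
  assumes i: "i < k" and F[measurable]: "F \<in> borel_measurable (Q \<Otimes>\<^sub>M Q)"
  shows "(\<integral>\<^sup>+y. \<integral>\<^sup>+s. F (y, y(i := s)) \<partial>S \<partial>Q) = (\<integral>\<^sup>+y. \<integral>\<^sup>+s. F (y(i := s), y) \<partial>S \<partial>Q)"
proof -
  define J where "J = {..<k} - {i}"
  have J: "finite J" "i \<notin> J" "insert i J = {..<k}" using i by (auto simp: J_def)
  have QJ: "Q = PiM (insert i J) (\<lambda>_. S)" by (simp add: Q_def J)
  note upd[measurable] = measurable_update_slot[OF i]
  have z[measurable]: "(\<lambda>t. z(i := t)) \<in> measurable S Q" if "z \<in> space (PiM J (\<lambda>_. S))" for z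
    unfolding QJ using that J by (intro measurable_fun_upd[where J = J]) auto
  have ins: "(\<integral>\<^sup>+y. g y \<partial>Q) = (\<integral>\<^sup>+z. \<integral>\<^sup>+t. g (z(i := t)) \<partial>S \<partial>PiM J (\<lambda>_. S))"
    if "g \<in> borel_measurable Q" for g
    unfolding QJ by (rule SP.product_nn_integral_insert) (use J that in \<open>auto simp: QJ\<close>)
  interpret SS: pair_sigma_finite S S by unfold_locales
  have m1: "(\<lambda>p. F (fst p, (fst p)(i := snd p))) \<in> borel_measurable (Q \<Otimes>\<^sub>M S)"
    "(\<lambda>p. F ((fst p)(i := snd p), fst p)) \<in> borel_measurable (Q \<Otimes>\<^sub>M S)"
    by measurable
  have m2: "(\<lambda>y. \<integral>\<^sup>+s. F (y, y(i := s)) \<partial>S) \<in> borel_measurable Q"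
    "(\<lambda>y. \<integral>\<^sup>+s. F (y(i := s), y) \<partial>S) \<in> borel_measurable Q"
    using S.borel_measurable_nn_integral_fst[OF m1(1)] S.borel_measurable_nn_integral_fst[OF m1(2)] by simp_all
  have "(\<integral>\<^sup>+y. \<integral>\<^sup>+s. F (y, y(i := s)) \<partial>S \<partial>Q)
      = (\<integral>\<^sup>+z. \<integral>\<^sup>+t. \<integral>\<^sup>+s. F (z(i := t), z(i := s)) \<partial>S \<partial>S \<partial>PiM J (\<lambda>_. S))"
    by (subst ins[OF m2(1)]) simp
  \<comment> \<open>With the common slots \<open>z\<close> fixed, the two copies of slot
    \<open>i\<close> are exchanged by Fubini.\<close>
  also have "\<dots> = (\<integral>\<^sup>+z. \<integral>\<^sup>+s. \<integral>\<^sup>+t. F (z(i := t), z(i := s)) \<partial>S \<partial>S \<partial>PiM J (\<lambda>_. S))"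
  proof (rule nn_integral_cong)
    fix z assume "z \<in> space (PiM J (\<lambda>_. S))"
    note z[OF this, measurable]
    show "(\<integral>\<^sup>+t. \<integral>\<^sup>+s. F (z(i := t), z(i := s)) \<partial>S \<partial>S) = (\<integral>\<^sup>+s. \<integral>\<^sup>+t. F (z(i := t), z(i := s)) \<partial>S \<partial>S)"
      by (rule SS.Fubini'[symmetric]) measurable
  qed
  also have "\<dots> = (\<integral>\<^sup>+y. \<integral>\<^sup>+s. F (y(i := s), y) \<partial>S \<partial>Q)"
    by (subst ins[OF m2(2)]) simp
  finally show ?thesis .
qed

lemma nn_integral_slot_pair:
  assumes i: "i < k" and [measurable]: "case_prod f \<in> borel_measurable (S \<Otimes>\<^sub>M S)"
  shows "(\<integral>\<^sup>+y. \<integral>\<^sup>+s. f (y i) s \<partial>S \<partial>Q) = (\<integral>\<^sup>+t. \<integral>\<^sup>+s. f t s \<partial>S \<partial>S)"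
proof -
  have "distr Q S (\<lambda>y. y i) = S"
    unfolding Q_def using i by (intro distr_PiM_component) (auto intro: S.prob_space_axioms)
  then have "(\<integral>\<^sup>+t. \<integral>\<^sup>+s. f t s \<partial>S \<partial>S) = (\<integral>\<^sup>+t. \<integral>\<^sup>+s. f t s \<partial>S \<partial>distr Q S (\<lambda>y. y i))"
    by simp
  also have "\<dots> = (\<integral>\<^sup>+y. \<integral>\<^sup>+s. f (y i) s \<partial>S \<partial>Q)"
    using i by (subst nn_integral_distr) (auto simp: Q_def)
  finally show ?thesis by simp
qed

end

section \<open>The conditioned law of the slots and its invariance under the sweep\<close>

locale conditioned_slots = poisson_slots D \<mu> k
  for D :: "'a::metric_space measure" and \<mu> k +
  fixes C :: "'a measure set"
  assumes C [measurable]: "C \<in> sets config_space"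
    and C_pos: "emeasure Q {y \<in> space Q. superpose k y \<in> C} \<noteq> 0"
begin

definition G where "G = {y \<in> space Q. superpose k y \<in> C}"
definition QC where "QC = uniform_measure Q G"

lemma measurable_G [measurable]: "G \<in> sets Q"
  unfolding G_def by measurable

lemma sets_QC [measurable_cong]: "sets QC = sets Q"
  by (simp add: QC_def)

lemma G_pos: "emeasure Q G \<noteq> 0" using C_pos by (simp add: G_def)

sublocale QC: prob_space QC
  unfolding QC_def using G_pos by (intro prob_space_uniform_measure) simp_all

lemma nn_integral_QC:
  assumes "f \<in> borel_measurable Q"
  shows "(\<integral>\<^sup>+y. f y \<partial>QC) = (\<integral>\<^sup>+y. f y * indicator G y \<partial>Q) / emeasure Q G"
  unfolding QC_def using assms by (intro nn_integral_uniform_measure) auto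

lemma measurable_metropolis_step:
  assumes "i < k"
  shows "(\<lambda>p. metropolis_step C k i (fst p) (snd p)) \<in> measurable (Q \<Otimes>\<^sub>M S) Q"
  unfolding metropolis_step_def using measurable_update_slot[OF assms] by measurable

text \<open>Detailed balance: accepted moves are pairs of states that both lie in \<open>G\<close>,
  and the swap of old and new state preserves their law; rejected moves leave the state where it
  was.\<close>

lemma metropolis_step_invariant:
  assumes i: "i < k" and g[measurable]: "g \<in> borel_measurable Q"
  shows "(\<integral>\<^sup>+y. \<integral>\<^sup>+s. g (metropolis_step C k i y s) \<partial>S \<partial>QC) = (\<integral>\<^sup>+y. g y \<partial>QC)"
proof -
  note [measurable] = measurable_update_slot[OF i]
  note step[measurable] = measurable_metropolis_step[OF i]
  have upd_space: "y(i := s) \<in> space Q" if "y \<in> space Q" "s \<in> space S" for y s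
    using measurable_space[OF measurable_update_slot[OF i], of "(y, s)"] that by (simp add: space_pair_measure)
  \<comment> \<open>\<open>F\<close> carries the accepted moves and evaluates \<open>g\<close> at
    the new state; \<open>H\<close> carries the rejected ones and evaluates \<open>g\<close> at the
    old state. Only \<open>F\<close> has to be swapped.\<close>
  define F where "F = (\<lambda>(y, y'). g y' * indicator G y * indicator G y')"
  define H where "H = (\<lambda>(y, y'). g y * indicator G y * indicator (space Q - G) y')"
  have F[measurable]: "F \<in> borel_measurable (Q \<Otimes>\<^sub>M Q)" unfolding F_def by measurable
  have H[measurable]: "H \<in> borel_measurable (Q \<Otimes>\<^sub>M Q)" unfolding H_def by measurable
  have mg: "(\<lambda>p. g (metropolis_step C k i (fst p) (snd p))) \<in> borel_measurable (Q \<Otimes>\<^sub>M S)" by measurable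
  have mg': "(\<lambda>y. \<integral>\<^sup>+s. g (metropolis_step C k i y s) \<partial>S) \<in> borel_measurable Q"
    using S.borel_measurable_nn_integral_fst[OF mg] by simp
  have m1: "(\<lambda>p. F (fst p, (fst p)(i := snd p))) \<in> borel_measurable (Q \<Otimes>\<^sub>M S)"
    "(\<lambda>p. F ((fst p)(i := snd p), fst p)) \<in> borel_measurable (Q \<Otimes>\<^sub>M S)"
    "(\<lambda>p. H (fst p, (fst p)(i := snd p))) \<in> borel_measurable (Q \<Otimes>\<^sub>M S)" by measurable
  have m2: "(\<lambda>y. \<integral>\<^sup>+s. F (y, y(i := s)) \<partial>S) \<in> borel_measurable Q"
    "(\<lambda>y. \<integral>\<^sup>+s. F (y(i := s), y) \<partial>S) \<in> borel_measurable Q"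
    "(\<lambda>y. \<integral>\<^sup>+s. H (y, y(i := s)) \<partial>S) \<in> borel_measurable Q"
    using S.borel_measurable_nn_integral_fst[OF m1(1)] S.borel_measurable_nn_integral_fst[OF m1(2)]
      S.borel_measurable_nn_integral_fst[OF m1(3)] by simp_all
  have mS: "(\<lambda>s. f (y, s)) \<in> borel_measurable S" if "y \<in> space Q" "f \<in> borel_measurable (Q \<Otimes>\<^sub>M S)"
    for f :: "_ \<Rightarrow> ennreal" and y
    using that(2,1) by (rule measurable_Pair2)
  have "(\<integral>\<^sup>+y. (\<integral>\<^sup>+s. g (metropolis_step C k i y s) \<partial>S) * indicator G y \<partial>Q)
      = (\<integral>\<^sup>+y. (\<integral>\<^sup>+s. F (y, y(i := s)) \<partial>S) + (\<integral>\<^sup>+s. H (y, y(i := s)) \<partial>S) \<partial>Q)"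
  proof (rule nn_integral_cong)
    fix y assume y: "y \<in> space Q"
    have "(\<integral>\<^sup>+s. g (metropolis_step C k i y s) \<partial>S) * indicator G y
        = (\<integral>\<^sup>+s. g (metropolis_step C k i y s) * indicator G y \<partial>S)"
      using mS[OF y mg] by (subst nn_integral_multc) auto
    also have "\<dots> = (\<integral>\<^sup>+s. F (y, y(i := s)) + H (y, y(i := s)) \<partial>S)"
      using y upd_space[OF y]
      by (intro nn_integral_cong) (auto simp: metropolis_step_def F_def H_def G_def indicator_def)
    also have "\<dots> = (\<integral>\<^sup>+s. F (y, y(i := s)) \<partial>S) + (\<integral>\<^sup>+s. H (y, y(i := s)) \<partial>S)"
      using mS[OF y m1(1)] mS[OF y m1(3)] by (intro nn_integral_add) auto
    finally show "(\<integral>\<^sup>+s. g (metropolis_step C k i y s) \<partial>S) * indicator G y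
        = (\<integral>\<^sup>+s. F (y, y(i := s)) \<partial>S) + (\<integral>\<^sup>+s. H (y, y(i := s)) \<partial>S)" .
  qed
  also have "\<dots> = (\<integral>\<^sup>+y. \<integral>\<^sup>+s. F (y, y(i := s)) \<partial>S \<partial>Q) + (\<integral>\<^sup>+y. \<integral>\<^sup>+s. H (y, y(i := s)) \<partial>S \<partial>Q)"
    using m2 by (intro nn_integral_add) auto
  also have "\<dots> = (\<integral>\<^sup>+y. \<integral>\<^sup>+s. F (y(i := s), y) \<partial>S \<partial>Q) + (\<integral>\<^sup>+y. \<integral>\<^sup>+s. H (y, y(i := s)) \<partial>S \<partial>Q)"
    using nn_integral_update_slot_swap[OF i F] by simp
  also have "\<dots> = (\<integral>\<^sup>+y. (\<integral>\<^sup>+s. F (y(i := s), y) \<partial>S) + (\<integral>\<^sup>+s. H (y, y(i := s)) \<partial>S) \<partial>Q)"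
    using m2 by (intro nn_integral_add[symmetric]) auto
  also have "\<dots> = (\<integral>\<^sup>+y. g y * indicator G y \<partial>Q)"
  proof (rule nn_integral_cong)
    fix y assume y: "y \<in> space Q"
    have "(\<integral>\<^sup>+s. F (y(i := s), y) \<partial>S) + (\<integral>\<^sup>+s. H (y, y(i := s)) \<partial>S)
        = (\<integral>\<^sup>+s. F (y(i := s), y) + H (y, y(i := s)) \<partial>S)"
      using mS[OF y m1(2)] mS[OF y m1(3)] by (intro nn_integral_add[symmetric]) auto
    \<comment> \<open>After the swap both terms contain \<open>g y * indicator G y\<close>,
      multiplied by the indicators of the complementary events that \<open>y(i := s)\<close> lies in
      \<open>G\<close> or not.\<close>
    also have "\<dots> = (\<integral>\<^sup>+s. g y * indicator G y \<partial>S)"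
      using y upd_space[OF y]
      by (intro nn_integral_cong) (auto simp: F_def H_def indicator_def)
    finally show "(\<integral>\<^sup>+s. F (y(i := s), y) \<partial>S) + (\<integral>\<^sup>+s. H (y, y(i := s)) \<partial>S) = g y * indicator G y"
      by (simp add: S.emeasure_space_1)
  qed
  finally show ?thesis
    using mg' g by (simp add: nn_integral_QC)
qed

lemma measurable_sweep:
  assumes "i \<le> j" "i \<le> k"
  shows "(\<lambda>p. sweep C k i (fst p) (snd p)) \<in> measurable (Q \<Otimes>\<^sub>M PiM {..<j} (\<lambda>_. S)) Q"
  using assms
proof (induction i)
  case (Suc i)
  then have [measurable]: "(\<lambda>p. sweep C k i (fst p) (snd p)) \<in> measurable (Q \<Otimes>\<^sub>M PiM {..<j} (\<lambda>_. S)) Q"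
    by simp
  have [measurable]: "(\<lambda>p. snd p i) \<in> measurable (Q \<Otimes>\<^sub>M PiM {..<j} (\<lambda>_. S)) S"
    using Suc.prems by (intro measurable_compose[OF measurable_snd measurable_component_singleton]) auto
  have "(\<lambda>p. (sweep C k i (fst p) (snd p), snd p i)) \<in> measurable (Q \<Otimes>\<^sub>M PiM {..<j} (\<lambda>_. S)) (Q \<Otimes>\<^sub>M S)"
    by measurable
  from measurable_compose[OF this measurable_metropolis_step[of i]] Suc.prems
  show ?case by simp
qed simp

text \<open>The last noise entry is integrated first; the resulting function of the state after
  \<open>i\<close> steps is the new test function for the induction, and invariance of a single step
  removes it.\<close>

lemma nn_integral_sweep:
  assumes "i \<le> k" "g \<in> borel_measurable Q"
  shows "(\<integral>\<^sup>+y. \<integral>\<^sup>+\<xi>. g (sweep C k i y \<xi>) \<partial>PiM {..<i} (\<lambda>_. S) \<partial>QC) = (\<integral>\<^sup>+y. g y \<partial>QC)"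
  using assms
proof (induction i arbitrary: g)
  case 0
  interpret P: prob_space "PiM {..<0::nat} (\<lambda>_. S)" by (intro prob_space_PiM S.prob_space_axioms)
  show ?case by (simp add: P.emeasure_space_1 del: lessThan_0)
next
  case (Suc i)
  note [measurable] = Suc.prems(2)
  have i: "i < k" using Suc.prems by simp
  have step: "(\<lambda>p. g (metropolis_step C k i (fst p) (snd p))) \<in> borel_measurable (Q \<Otimes>\<^sub>M S)"
    using measurable_metropolis_step[OF i] by measurable
  have step': "(\<lambda>y. \<integral>\<^sup>+s. g (metropolis_step C k i y s) \<partial>S) \<in> borel_measurable Q"
    using S.borel_measurable_nn_integral_fst[OF step] by simp
  have "(\<integral>\<^sup>+y. \<integral>\<^sup>+\<xi>. g (sweep C k (Suc i) y \<xi>) \<partial>PiM {..<Suc i} (\<lambda>_. S) \<partial>QC)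
      = (\<integral>\<^sup>+y. \<integral>\<^sup>+\<xi>. \<integral>\<^sup>+s. g (metropolis_step C k i (sweep C k i y \<xi>) s) \<partial>S \<partial>PiM {..<i} (\<lambda>_. S) \<partial>QC)"
  proof (rule nn_integral_cong)
    fix y assume "y \<in> space QC"
    then have y: "y \<in> space Q" using sets_eq_imp_space_eq[OF sets_QC] by simp
    have m: "(\<lambda>\<xi>. g (sweep C k (Suc i) y \<xi>)) \<in> borel_measurable (PiM {..<Suc i} (\<lambda>_. S))"
      using measurable_Pair2[OF measurable_sweep[of "Suc i" "Suc i"] y] Suc.prems by simp
    have "(\<integral>\<^sup>+\<xi>. g (sweep C k (Suc i) y \<xi>) \<partial>PiM {..<Suc i} (\<lambda>_. S))
        = (\<integral>\<^sup>+\<xi>. \<integral>\<^sup>+s. g (sweep C k (Suc i) y (\<xi>(i := s))) \<partial>S \<partial>PiM {..<i} (\<lambda>_. S))"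
      using m unfolding lessThan_Suc by (intro SP.product_nn_integral_insert) auto
    also have "\<dots> = (\<integral>\<^sup>+\<xi>. \<integral>\<^sup>+s. g (metropolis_step C k i (sweep C k i y \<xi>) s) \<partial>S \<partial>PiM {..<i} (\<lambda>_. S))"
    proof -
      have "sweep C k i y (\<xi>(i := s)) = sweep C k i y \<xi>" for \<xi> s
        by (rule sweep_cong) auto
      then show ?thesis by simp
    qed
    finally show "(\<integral>\<^sup>+\<xi>. g (sweep C k (Suc i) y \<xi>) \<partial>PiM {..<Suc i} (\<lambda>_. S))
        = (\<integral>\<^sup>+\<xi>. \<integral>\<^sup>+s. g (metropolis_step C k i (sweep C k i y \<xi>) s) \<partial>S \<partial>PiM {..<i} (\<lambda>_. S))" .
  qed
  also have "\<dots> = (\<integral>\<^sup>+y. \<integral>\<^sup>+s. g (metropolis_step C k i y s) \<partial>S \<partial>QC)"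
    using Suc.IH[OF _ step'] i by simp
  also have "\<dots> = (\<integral>\<^sup>+y. g y \<partial>QC)"
    by (rule metropolis_step_invariant[OF i Suc.prems(2)])
  finally show ?case .
qed

text \<open>The state before step \<open>i\<close> has law \<open>QC\<close> and is independent of
  \<open>\<xi> i\<close>, so the pair of state and proposal is that of a stationary step.\<close>

lemma nn_integral_sweep_fresh:
  assumes i: "i < k" and F: "F \<in> borel_measurable (Q \<Otimes>\<^sub>M S)"
  shows "(\<integral>\<^sup>+y. \<integral>\<^sup>+\<xi>. F (sweep C k i y \<xi>, \<xi> i) \<partial>Q \<partial>QC) = (\<integral>\<^sup>+y. \<integral>\<^sup>+s. F (y, s) \<partial>S \<partial>QC)"
proof -
  have F': "(\<lambda>y. \<integral>\<^sup>+s. F (y, s) \<partial>S) \<in> borel_measurable Q"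
    using S.borel_measurable_nn_integral_fst[OF F] by simp
  have "(\<integral>\<^sup>+y. \<integral>\<^sup>+\<xi>. F (sweep C k i y \<xi>, \<xi> i) \<partial>Q \<partial>QC)
      = (\<integral>\<^sup>+y. \<integral>\<^sup>+\<xi>. \<integral>\<^sup>+s. F (sweep C k i y \<xi>, s) \<partial>S \<partial>PiM {..<i} (\<lambda>_. S) \<partial>QC)"
  proof (rule nn_integral_cong)
    fix y assume "y \<in> space QC"
    then have y: "y \<in> space Q" using sets_eq_imp_space_eq[OF sets_QC] by simp
    have "(\<lambda>p. (sweep C k i (fst p) (snd p), snd p i)) \<in> measurable (Q \<Otimes>\<^sub>M PiM {..<Suc i} (\<lambda>_. S)) (Q \<Otimes>\<^sub>M S)"
      using measurable_sweep[of i "Suc i"] i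
      by (intro measurable_Pair measurable_compose[OF measurable_snd measurable_component_singleton]) auto
    from measurable_Pair2[OF measurable_compose[OF this F] y]
    have m: "(\<lambda>\<xi>. F (sweep C k i y \<xi>, \<xi> i)) \<in> borel_measurable (PiM {..<Suc i} (\<lambda>_. S))"
      by simp
    have r: "sweep C k i y (restrict \<xi> {..<Suc i}) = sweep C k i y \<xi>" for \<xi>
      by (rule sweep_cong) auto
    have u: "sweep C k i y (\<xi>(i := s)) = sweep C k i y \<xi>" for \<xi> s
      by (rule sweep_cong) auto
    \<comment> \<open>Entries of \<open>\<xi>\<close> beyond \<open>i\<close> do not enter and are
      projected away.\<close>
    have "(\<integral>\<^sup>+\<xi>. F (sweep C k i y \<xi>, \<xi> i) \<partial>PiM {..<Suc i} (\<lambda>_. S))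
        = (\<integral>\<^sup>+\<xi>. F (sweep C k i y \<xi>, \<xi> i) \<partial>distr Q (PiM {..<Suc i} (\<lambda>_. S)) (\<lambda>f. restrict f {..<Suc i}))"
      unfolding Q_def using i by (subst SP.distr_restrict[of "{..<Suc i}" "{..<k}"]) auto
    also have "\<dots> = (\<integral>\<^sup>+\<xi>. F (sweep C k i y \<xi>, \<xi> i) \<partial>Q)"
      using m i by (subst nn_integral_distr) (auto simp: r Q_def intro!: measurable_restrict_subset)
    finally have "(\<integral>\<^sup>+\<xi>. F (sweep C k i y \<xi>, \<xi> i) \<partial>Q)
        = (\<integral>\<^sup>+\<xi>. F (sweep C k i y \<xi>, \<xi> i) \<partial>PiM {..<Suc i} (\<lambda>_. S))" by simp
    also have "\<dots> = (\<integral>\<^sup>+\<xi>. \<integral>\<^sup>+s. F (sweep C k i y (\<xi>(i := s)), (\<xi>(i := s)) i) \<partial>S \<partial>PiM {..<i} (\<lambda>_. S))"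
      using m unfolding lessThan_Suc by (intro SP.product_nn_integral_insert) auto
    finally show "(\<integral>\<^sup>+\<xi>. F (sweep C k i y \<xi>, \<xi> i) \<partial>Q)
        = (\<integral>\<^sup>+\<xi>. \<integral>\<^sup>+s. F (sweep C k i y \<xi>, s) \<partial>S \<partial>PiM {..<i} (\<lambda>_. S))"
      by (simp add: u)
  qed
  also have "\<dots> = (\<integral>\<^sup>+y. \<integral>\<^sup>+s. F (y, s) \<partial>S \<partial>QC)"
    using nn_integral_sweep[OF _ F'] i by simp
  finally show ?thesis .
qed

end

subsection \<open>Cost of the coupling\<close>

text \<open>The integrand \<open>f\<close> need not be measurable: \<open>nn_integral\<close> is the lower integral.\<close>

lemma nn_integral_distr_le:
  assumes T: "T \<in> measurable M N"
  shows "(\<integral>\<^sup>+x. f x \<partial>distr M N T) \<le> (\<integral>\<^sup>+x. f (T x) \<partial>M)"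
  unfolding nn_integral_def[of "distr M N T"]
proof (rule SUP_least)
  fix g assume "g \<in> {g. simple_function (distr M N T) g \<and> g \<le> f}"
  then have g: "simple_function (distr M N T) g" "g \<le> f" by auto
  have "integral\<^sup>S (distr M N T) g = (\<integral>\<^sup>+x. g x \<partial>distr M N T)"
    using g(1) by (rule nn_integral_eq_simple_integral[symmetric])
  also have "\<dots> = (\<integral>\<^sup>+x. g (T x) \<partial>M)"
    using T borel_measurable_simple_function[OF g(1)] by (rule nn_integral_distr)
  also have "\<dots> \<le> (\<integral>\<^sup>+x. f (T x) \<partial>M)"
    using g(2) by (intro nn_integral_mono) (auto simp: le_fun_def)
  finally show "integral\<^sup>S (distr M N T) g \<le> (\<integral>\<^sup>+x. f (T x) \<partial>M)" .
qed

section \<open>Moments of the numbers of points in the slots\<close>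

context poisson_slots
begin

lemma nn_integral_S_fst: "(\<integral>\<^sup>+s. f (fst s) \<partial>S) = (\<integral>\<^sup>+n. f n \<partial>poisson_count \<mu>)"
proof -
  have "(\<lambda>s. f (fst s)) \<in> borel_measurable S"
    by (rule measurable_compose[OF measurable_fst_S]) simp
  moreover have "emeasure (PiM UNIV (\<lambda>_ :: nat. D)) (space (PiM UNIV (\<lambda>_. D))) = 1"
    by (rule X.emeasure_space_1)
  ultimately show ?thesis by (simp add: nn_integral_S nn_integral_poisson_count)
qed

text \<open>Size biasing a Poisson law shifts it by one; the moments below follow by shifting the
  summation index.\<close>

lemma poisson_weight_Suc:
  fixes e :: real
  shows "\<mu> ^ Suc n / fact (Suc n) * e * real (Suc n) = \<mu> * (\<mu> ^ n / fact n * e)"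
proof -
  have *: "(\<mu> * A) / (N * F) * e * N = \<mu> * (A / F * e)" if "N \<noteq> 0" for A N F :: real
    using that by simp
  show ?thesis unfolding power_Suc fact_Suc by (rule *) simp
qed

lemma poisson_mean: "(\<integral>\<^sup>+s. of_nat (fst s) \<partial>S) = ennreal \<mu>"
proof -
  define c where "c n = \<mu> ^ n / fact n * exp (- \<mu>)" for n
  have "c sums 1" unfolding c_def using poisson_pgf_sums[of 1 \<mu>] by simp
  then have "(\<lambda>n. \<mu> * c n) sums \<mu>" using sums_mult[of c 1 \<mu>] by simp
  moreover have "\<mu> * c n = c (Suc n) * real (Suc n)" for n
    unfolding c_def by (rule poisson_weight_Suc[symmetric])
  ultimately have "(\<lambda>n. c (Suc n) * real (Suc n)) sums \<mu>" by simp
  then have "(\<lambda>n. c n * real n) sums \<mu>" using sums_Suc_iff[of "\<lambda>n. c n * real n" \<mu>] by simp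
  then have "(\<Sum>n. ennreal (c n * real n)) = ennreal \<mu>"
    using \<mu>_nonneg by (intro suminf_ennreal_eq) (auto simp: c_def)
  moreover have "ennreal (c n * real n) = ennreal (c n) * of_nat n" for n
    unfolding ennreal_of_nat_eq_real_of_nat using \<mu>_nonneg by (intro ennreal_mult) (simp_all add: c_def)
  ultimately show ?thesis
    using nn_integral_S_fst[of of_nat] by (simp add: nn_integral_poisson_count c_def)
qed

lemma poisson_factorial_moment: "(\<integral>\<^sup>+s. of_nat (fst s * (fst s - 1)) \<partial>S) = ennreal (\<mu>\<^sup>2)"
proof -
  define c where "c n = \<mu> ^ n / fact n * exp (- \<mu>)" for n
  have "c sums 1" unfolding c_def using poisson_pgf_sums[of 1 \<mu>] by simp
  then have "(\<lambda>n. \<mu>\<^sup>2 * c n) sums \<mu>\<^sup>2" using sums_mult[of c 1 "\<mu>\<^sup>2"] by simp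
  moreover have "\<mu>\<^sup>2 * c n = c (Suc (Suc n)) * real (Suc (Suc n) * (Suc (Suc n) - 1))" for n
  proof -
    have st: "c (Suc n) * real (Suc n) = \<mu> * c n" for n
      unfolding c_def by (rule poisson_weight_Suc)
    have "c (Suc (Suc n)) * real (Suc (Suc n) * (Suc (Suc n) - 1)) = c (Suc (Suc n)) * real (Suc (Suc n)) * real (Suc n)"
      by (simp only: of_nat_mult diff_Suc_1 mult.assoc)
    also have "\<dots> = \<mu> * (c (Suc n) * real (Suc n))"
      by (simp only: st mult.assoc)
    also have "\<dots> = \<mu>\<^sup>2 * c n"
      by (simp only: st power2_eq_square mult.assoc)
    finally show ?thesis by simp
  qed
  ultimately have "(\<lambda>n. c (Suc (Suc n)) * real (Suc (Suc n) * (Suc (Suc n) - 1))) sums \<mu>\<^sup>2" by simp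
  then have "(\<lambda>n. c (Suc n) * real (Suc n * (Suc n - 1))) sums \<mu>\<^sup>2"
    using sums_Suc_iff[of "\<lambda>n. c (Suc n) * real (Suc n * (Suc n - 1))" "\<mu>\<^sup>2"] by simp
  then have "(\<lambda>n. c n * real (n * (n - 1))) sums \<mu>\<^sup>2"
    using sums_Suc_iff[of "\<lambda>n. c n * real (n * (n - 1))" "\<mu>\<^sup>2"] by simp
  then have "(\<Sum>n. ennreal (c n * real (n * (n - 1)))) = ennreal (\<mu>\<^sup>2)"
    using \<mu>_nonneg by (intro suminf_ennreal_eq) (auto simp: c_def)
  moreover have "ennreal (c n * real (n * (n - 1))) = ennreal (c n) * of_nat (n * (n - 1))" for n
    unfolding ennreal_of_nat_eq_real_of_nat using \<mu>_nonneg by (intro ennreal_mult) (simp_all add: c_def)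
  ultimately show ?thesis
    using nn_integral_S_fst[of "\<lambda>n. of_nat (n * (n - 1))"] by (simp add: nn_integral_poisson_count c_def)
qed

text \<open>The total of two independent slots is Poisson of mean \<open>2 * \<mu>\<close>, whose
  second factorial moment is the square of that mean. The proof expands the factorial power
  instead.\<close>

lemma nn_integral_two_slots:
  "(\<integral>\<^sup>+t. \<integral>\<^sup>+s. of_nat ((fst t + fst s) * (fst t + fst s - 1)) \<partial>S \<partial>S) = ennreal (4 * \<mu>\<^sup>2)"
proof -
  have e: "(of_nat ((a + b) * (a + b - 1)) :: ennreal)
      = of_nat (a * (a - 1)) + (2 * of_nat a) * of_nat b + of_nat (b * (b - 1))" for a b :: nat
  proof -
    have "(a + b) * (a + b - 1) = a * (a - 1) + 2 * a * b + b * (b - 1)"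
      by (cases a; cases b) (auto simp: algebra_simps)
    then show ?thesis by (simp only: of_nat_add of_nat_mult of_nat_numeral)
  qed
  have m: "(\<lambda>s. f (fst s)) \<in> borel_measurable S" for f :: "nat \<Rightarrow> ennreal"
    by (rule measurable_compose[OF measurable_fst_S]) simp
  note m1 = m[of of_nat] and m2 = m[of "\<lambda>b. of_nat (b * (b - 1))"]
  have "(\<integral>\<^sup>+s. of_nat ((fst t + fst s) * (fst t + fst s - 1)) \<partial>S)
      = of_nat (fst t * (fst t - 1)) + (2 * of_nat (fst t)) * ennreal \<mu> + ennreal (\<mu>\<^sup>2)" for t :: "nat \<times> (nat \<Rightarrow> 'a)"
  proof -
    have "(\<integral>\<^sup>+s. of_nat ((fst t + fst s) * (fst t + fst s - 1)) \<partial>S)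
        = (\<integral>\<^sup>+s. of_nat (fst t * (fst t - 1)) + (2 * of_nat (fst t)) * of_nat (fst s) \<partial>S)
          + (\<integral>\<^sup>+s. of_nat (fst s * (fst s - 1)) \<partial>S)"
      unfolding e
      by (rule nn_integral_add[OF m[of "\<lambda>b. of_nat (fst t * (fst t - 1)) + (2 * of_nat (fst t)) * of_nat b"] m2])
    also have "(\<integral>\<^sup>+s. of_nat (fst t * (fst t - 1)) + (2 * of_nat (fst t)) * of_nat (fst s) \<partial>S)
        = (\<integral>\<^sup>+s. of_nat (fst t * (fst t - 1)) \<partial>S) + (\<integral>\<^sup>+s. (2 * of_nat (fst t)) * of_nat (fst s) \<partial>S)"
      by (rule nn_integral_add[OF _ m[of "\<lambda>b. (2 * of_nat (fst t)) * of_nat b"]]) simp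
    also have "(\<integral>\<^sup>+s. (2 * of_nat (fst t)) * of_nat (fst s) \<partial>S) = (2 * of_nat (fst t)) * ennreal \<mu>"
      by (subst nn_integral_cmult[OF m1]) (simp only: poisson_mean)
    finally show ?thesis
      by (simp only: poisson_factorial_moment nn_integral_const S.emeasure_space_1 mult_1_right)
  qed
  then have "(\<integral>\<^sup>+t. \<integral>\<^sup>+s. of_nat ((fst t + fst s) * (fst t + fst s - 1)) \<partial>S \<partial>S)
      = (\<integral>\<^sup>+t. of_nat (fst t * (fst t - 1)) + ((2 * ennreal \<mu>) * of_nat (fst t) + ennreal (\<mu>\<^sup>2)) \<partial>S)"
    by (simp add: ac_simps del: of_nat_mult)
  also have "\<dots> = (\<integral>\<^sup>+t. of_nat (fst t * (fst t - 1)) \<partial>S) + ((2 * ennreal \<mu>) * (\<integral>\<^sup>+t. of_nat (fst t) \<partial>S) + ennreal (\<mu>\<^sup>2))"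
    using m1 m2
    by (simp add: nn_integral_add nn_integral_cmult S.emeasure_space_1 del: of_nat_mult)
  also have "\<dots> = ennreal (\<mu>\<^sup>2) + (2 * ennreal \<mu> * ennreal \<mu> + ennreal (\<mu>\<^sup>2))"
    by (simp only: poisson_mean poisson_factorial_moment)
  also have "2 * ennreal \<mu> * ennreal \<mu> = ennreal (2 * \<mu>\<^sup>2)"
    using \<mu>_nonneg by (simp add: ennreal_mult power2_eq_square mult.assoc)
  also have "ennreal (\<mu>\<^sup>2) + (ennreal (2 * \<mu>\<^sup>2) + ennreal (\<mu>\<^sup>2)) = ennreal (4 * \<mu>\<^sup>2)"
    by (simp add: ennreal_plus[symmetric] del: ennreal_plus)
  finally show ?thesis .
qed

text \<open>A slot has exactly one point with probability \<open>\<mu> * exp (- \<mu>)\<close>, and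
  the exponential is bounded by 1.\<close>

lemma nn_integral_one_point_le:
  assumes h[measurable]: "h \<in> borel_measurable borel"
  shows "(\<integral>\<^sup>+s. (if fst s = 1 then h (snd s 0) else 0) \<partial>S) \<le> ennreal \<mu> * (\<integral>\<^sup>+x. h x \<partial>D)"
proof -
  have m: "(\<lambda>s. if fst s = 1 then h (snd s 0) else 0) \<in> borel_measurable S"
    by measurable
  have "(\<integral>\<^sup>+s. (if fst s = 1 then h (snd s 0) else 0) \<partial>S)
      = (\<Sum>n. ennreal (\<mu> ^ n / fact n * exp (- \<mu>)) * (\<integral>\<^sup>+x. (if n = 1 then h (x 0) else 0) \<partial>PiM UNIV (\<lambda>_ :: nat. D)))"
    using nn_integral_S[OF m] by (simp only: fst_conv snd_conv)
  also have "\<dots> = (\<Sum>n\<in>{1}. ennreal (\<mu> ^ n / fact n * exp (- \<mu>)) * (\<integral>\<^sup>+x. (if n = 1 then h (x 0) else 0) \<partial>PiM UNIV (\<lambda>_ :: nat. D)))"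
    by (rule suminf_finite) auto
  also have "\<dots> = ennreal (\<mu> * exp (- \<mu>)) * (\<integral>\<^sup>+x. h x \<partial>D)"
    using nn_integral_sample_prod[OF h, of 1] by simp
  also have "\<dots> \<le> ennreal \<mu> * (\<integral>\<^sup>+x. h x \<partial>D)"
    using \<mu>_nonneg by (intro mult_right_mono ennreal_leI) (auto simp: mult_left_le)
  finally show ?thesis .
qed

end

section \<open>The coupling produced by the sweep and the mean cost of one step\<close>

context conditioned_slots
begin

text \<open>Conditioning on a preimage commutes with the pushforward.\<close>

lemma distr_QC:
  "distr QC config_space (superpose k) = uniform_measure (distr Q config_space (superpose k)) C"
proof (rule measure_eqI)
  fix A assume "A \<in> sets (distr QC config_space (superpose k))"
  then have A[measurable]: "A \<in> sets config_space" by simp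
  have m: "superpose k \<in> measurable QC config_space"
    using measurable_superpose by (simp cong: measurable_cong_sets add: sets_QC)
  have [simp]: "space QC = space Q" using sets_eq_imp_space_eq[OF sets_QC] .
  have G: "superpose k -` C \<inter> space Q = G" by (auto simp: G_def)
  have "emeasure (distr QC config_space (superpose k)) A = emeasure QC (superpose k -` A \<inter> space Q)"
    using m by (simp add: emeasure_distr)
  also have "\<dots> = emeasure Q (G \<inter> (superpose k -` A \<inter> space Q)) / emeasure Q G"
    unfolding QC_def by (rule emeasure_uniform_measure) measurable
  also have "G \<inter> (superpose k -` A \<inter> space Q) = superpose k -` (C \<inter> A) \<inter> space Q"
    by (auto simp: G_def)
  finally show "emeasure (distr QC config_space (superpose k)) A
      = emeasure (uniform_measure (distr Q config_space (superpose k)) C) A"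
    by (simp add: emeasure_distr G)
qed simp

text \<open>The loss of the factor \<open>1 / emeasure Q G\<close> is harmless for terms that vanish
  or are of order \<open>\<mu>\<^sup>2\<close>, because \<open>emeasure Q G\<close> is the
  probability of \<open>C\<close> whatever \<open>k\<close> is.\<close>

lemma nn_integral_QC_le:
  assumes "f \<in> borel_measurable Q"
  shows "(\<integral>\<^sup>+y. f y \<partial>QC) \<le> (\<integral>\<^sup>+y. f y \<partial>Q) / emeasure Q G"
  unfolding nn_integral_QC[OF assms]
  by (intro divide_right_mono_ennreal nn_integral_mono) (auto simp: indicator_def)

lemma measurable_component: "j < k \<Longrightarrow> (\<lambda>y. y j) \<in> measurable Q S"
  unfolding Q_def by (rule measurable_component_singleton) simp

lemma measurable_rejection_cost:
  assumes j: "j < k"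
  shows "(\<lambda>p. of_nat (rejection_cost C k j (fst p) (snd p)) :: ennreal) \<in> borel_measurable (Q \<Otimes>\<^sub>M S)"
proof -
  note [measurable] = measurable_update_slot[OF j]
  have [measurable]: "(\<lambda>p. fst (fst p j)) \<in> measurable (Q \<Otimes>\<^sub>M S) (count_space UNIV)"
    by (rule measurable_compose[OF measurable_compose[OF measurable_fst measurable_component[OF j]] measurable_fst_S])
  have "(\<lambda>p. rejection_cost C k j (fst p) (snd p)) \<in> measurable (Q \<Otimes>\<^sub>M S) (count_space UNIV)"
    unfolding rejection_cost_def by measurable
  then show ?thesis by measurable
qed

text \<open>The coupling is the joint law of the superpositions of the swept vector and of the noise
  vector \<open>\<xi>\<close>, with start \<open>y\<close> and noise independent.\<close>

lemma tv_star_le_rejection_cost: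
  "tv_star (distr QC config_space (superpose k)) (distr Q config_space (superpose k))
    \<le> (\<Sum>j<k. \<integral>\<^sup>+y. \<integral>\<^sup>+s. of_nat (rejection_cost C k j y s) \<partial>S \<partial>QC)"
proof -
  define W where "W = (\<lambda>p. (superpose k (sweep C k k (fst p) (snd p)), superpose k (snd p)))"
  define \<Gamma> where "\<Gamma> = distr (QC \<Otimes>\<^sub>M Q) (config_space \<Otimes>\<^sub>M config_space) W"
  interpret QQ: pair_prob_space QC Q by unfold_locales
  have sw: "(\<lambda>p. sweep C k k (fst p) (snd p)) \<in> measurable (QC \<Otimes>\<^sub>M Q) Q"
    using measurable_sweep[of k k]
    by (simp add: Q_def[symmetric] cong: measurable_cong_sets[OF sets_pair_measure_cong[OF sets_QC refl] refl])
  note [measurable] = sw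
  have W[measurable]: "W \<in> measurable (QC \<Otimes>\<^sub>M Q) (config_space \<Otimes>\<^sub>M config_space)"
    unfolding W_def by measurable
  \<comment> \<open>Invariance of the conditioned law identifies the first marginal of the
    coupling.\<close>
  have sweep_QC: "distr (QC \<Otimes>\<^sub>M Q) Q (\<lambda>p. sweep C k k (fst p) (snd p)) = QC"
  proof (rule measure_eqI)
    fix A assume "A \<in> sets (distr (QC \<Otimes>\<^sub>M Q) Q (\<lambda>p. sweep C k k (fst p) (snd p)))"
    then have A[measurable]: "A \<in> sets Q" by simp
    have "emeasure (distr (QC \<Otimes>\<^sub>M Q) Q (\<lambda>p. sweep C k k (fst p) (snd p))) A
        = (\<integral>\<^sup>+y. indicator A y \<partial>distr (QC \<Otimes>\<^sub>M Q) Q (\<lambda>p. sweep C k k (fst p) (snd p)))"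
      by simp
    also have "\<dots> = (\<integral>\<^sup>+p. indicator A (sweep C k k (fst p) (snd p)) \<partial>(QC \<Otimes>\<^sub>M Q))"
      using sw by (rule nn_integral_distr) simp
    also have "\<dots> = (\<integral>\<^sup>+y. \<integral>\<^sup>+\<xi>. indicator A (sweep C k k y \<xi>) \<partial>Q \<partial>QC)"
      by (subst Q.nn_integral_fst[symmetric]) simp_all
    also have "\<dots> = (\<integral>\<^sup>+y. indicator A y \<partial>QC)"
      using nn_integral_sweep[of k "indicator A"] by (simp add: Q_def[symmetric])
    finally show "emeasure (distr (QC \<Otimes>\<^sub>M Q) Q (\<lambda>p. sweep C k k (fst p) (snd p))) A = emeasure QC A"
      by (simp add: sets_QC)
  qed (simp add: sets_QC)
  have "distr \<Gamma> config_space fst = distr (distr (QC \<Otimes>\<^sub>M Q) Q (\<lambda>p. sweep C k k (fst p) (snd p))) config_space (superpose k)"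
    unfolding \<Gamma>_def by (subst (1 2) distr_distr) (auto simp: W_def comp_def)
  moreover have "distr \<Gamma> config_space snd = distr (distr (QC \<Otimes>\<^sub>M Q) Q snd) config_space (superpose k)"
    unfolding \<Gamma>_def by (subst (1 2) distr_distr) (auto simp: W_def comp_def)
  moreover have "distr (QC \<Otimes>\<^sub>M Q) Q snd = Q"
  proof (rule measure_eqI)
    fix A assume "A \<in> sets (distr (QC \<Otimes>\<^sub>M Q) Q snd)"
    then have A: "A \<in> sets Q" by simp
    have "snd -` A \<inter> space (QC \<Otimes>\<^sub>M Q) = space QC \<times> A"
      using sets.sets_into_space[OF A] by (auto simp: space_pair_measure)
    then show "emeasure (distr (QC \<Otimes>\<^sub>M Q) Q snd) A = emeasure Q A"
      using A by (simp add: emeasure_distr Q.emeasure_pair_measure_Times QC.emeasure_space_1)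
  qed simp
  ultimately have "\<Gamma> \<in> couplings (distr QC config_space (superpose k)) (distr Q config_space (superpose k))"
    by (simp add: couplings_def sweep_QC \<Gamma>_def)
  then have "tv_star (distr QC config_space (superpose k)) (distr Q config_space (superpose k))
      \<le> (\<integral>\<^sup>+ (\<omega>\<^sub>1, \<omega>\<^sub>2). tv_dist \<omega>\<^sub>1 \<omega>\<^sub>2 \<partial>\<Gamma>)"
    unfolding tv_star_def by (rule INF_lower)
  \<comment> \<open>Only an inequality is claimed for the pushforward, so \<open>tv_dist\<close> may
    fail to be measurable.\<close>
  also have "\<dots> \<le> (\<integral>\<^sup>+p. (case W p of (\<omega>\<^sub>1, \<omega>\<^sub>2) \<Rightarrow> tv_dist \<omega>\<^sub>1 \<omega>\<^sub>2) \<partial>(QC \<Otimes>\<^sub>M Q))"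
    unfolding \<Gamma>_def using W by (rule nn_integral_distr_le)
  also have "\<dots> \<le> (\<integral>\<^sup>+p. (\<Sum>j<k. of_nat (rejection_cost C k j (sweep C k j (fst p) (snd p)) (snd p j))) \<partial>(QC \<Otimes>\<^sub>M Q))"
    unfolding W_def using tv_dist_sweep_le[of k C] by (intro nn_integral_mono) simp
  also have "\<dots> = (\<Sum>j<k. \<integral>\<^sup>+y. \<integral>\<^sup>+s. of_nat (rejection_cost C k j y s) \<partial>S \<partial>QC)"
  proof -
    have m: "(\<lambda>p. of_nat (rejection_cost C k j (sweep C k j (fst p) (snd p)) (snd p j)) :: ennreal)
        \<in> borel_measurable (QC \<Otimes>\<^sub>M Q)" if j: "j < k" for j
    proof -
      have "(\<lambda>p. sweep C k j (fst p) (snd p)) \<in> measurable (QC \<Otimes>\<^sub>M Q) Q"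
        using measurable_sweep[of j k] j
        by (simp add: Q_def[symmetric] cong: measurable_cong_sets[OF sets_pair_measure_cong[OF sets_QC refl] refl])
      moreover have "(\<lambda>p. snd p j) \<in> measurable (QC \<Otimes>\<^sub>M Q) S"
        by (rule measurable_compose[OF measurable_snd measurable_component[OF j]])
      ultimately have "(\<lambda>p. (sweep C k j (fst p) (snd p), snd p j)) \<in> measurable (QC \<Otimes>\<^sub>M Q) (Q \<Otimes>\<^sub>M S)"
        by (rule measurable_Pair)
      from measurable_compose[OF this measurable_rejection_cost[OF j]] show ?thesis by simp
    qed
    have "(\<integral>\<^sup>+p. (\<Sum>j<k. of_nat (rejection_cost C k j (sweep C k j (fst p) (snd p)) (snd p j))) \<partial>(QC \<Otimes>\<^sub>M Q))
        = (\<Sum>j<k. \<integral>\<^sup>+p. of_nat (rejection_cost C k j (sweep C k j (fst p) (snd p)) (snd p j)) \<partial>(QC \<Otimes>\<^sub>M Q))"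
      using m by (intro nn_integral_sum) auto
    also have "\<dots> = (\<Sum>j<k. \<integral>\<^sup>+y. \<integral>\<^sup>+s. of_nat (rejection_cost C k j y s) \<partial>S \<partial>QC)"
    proof (rule sum.cong[OF refl])
      fix j assume "j \<in> {..<k}"
      then have j: "j < k" by simp
      show "(\<integral>\<^sup>+p. of_nat (rejection_cost C k j (sweep C k j (fst p) (snd p)) (snd p j)) \<partial>(QC \<Otimes>\<^sub>M Q))
          = (\<integral>\<^sup>+y. \<integral>\<^sup>+s. of_nat (rejection_cost C k j y s) \<partial>S \<partial>QC)"
        using nn_integral_sweep_fresh[OF j measurable_rejection_cost[OF j]]
          Q.nn_integral_fst[OF m[OF j]] by simp
    qed
    finally show ?thesis .
  qed
  finally show ?thesis .
qed

text \<open>An addition costs at most the first term, a deletion is rejected with probability 0 by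
  \<open>null\<close>, and everything with two or more points is absorbed by the second factorial
  moment. In \<open>null\<close> the configuration is unconditioned, since a rejected deletion leads
  to a configuration outside \<open>C\<close>.\<close>

lemma rejection_cost_le:
  assumes j: "j < k"
    and null: "ennreal \<mu> * (\<integral>\<^sup>+\<phi>. \<integral>\<^sup>+x. (if add_point \<phi> x \<in> C \<and> \<phi> \<notin> C then 1 else 0) \<partial>D
      \<partial>distr Q config_space (superpose k)) = 0"
  shows "(\<integral>\<^sup>+y. \<integral>\<^sup>+s. of_nat (rejection_cost C k j y s) \<partial>S \<partial>QC)
    \<le> ennreal \<mu> * (\<integral>\<^sup>+\<phi>. \<integral>\<^sup>+x. (if add_point \<phi> x \<notin> C then 1 else 0) \<partial>D \<partial>distr QC config_space (superpose k))
      + ennreal (4 * \<mu>\<^sup>2) / emeasure Q G"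
proof -
  note upd[measurable] = measurable_update_slot[OF j]
  note cj[measurable] = measurable_component[OF j]
  note add[measurable] = measurable_add_point
  have mD: "measurable (N \<Otimes>\<^sub>M D) K = measurable (N \<Otimes>\<^sub>M borel) K" for N :: "'b measure" and K :: "'c measure"
    by (rule measurable_cong_sets) (simp_all add: sets_D cong: sets_pair_measure_cong)
  have [measurable]: "(\<lambda>p. add_point (superpose k (fst p)) (snd (snd p) 0)) \<in> measurable (Q \<Otimes>\<^sub>M S) config_space"
    using measurable_compose[OF measurable_Pair[OF measurable_compose[OF measurable_fst measurable_superpose]
      measurable_compose[OF measurable_snd measurable_snd_S[of 0]]] measurable_add_point] by simp
  have [measurable]: "(\<lambda>p. fst (fst p j)) \<in> measurable (Q \<Otimes>\<^sub>M K) (count_space UNIV)" for K :: "'b measure"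
    by (rule measurable_compose[OF measurable_compose[OF measurable_fst cj] measurable_fst_S])
  have [measurable]: "(\<lambda>p. fst (snd p j)) \<in> measurable (Q \<Otimes>\<^sub>M Q) (count_space UNIV)"
    by (rule measurable_compose[OF measurable_compose[OF measurable_snd cj] measurable_fst_S])
  \<comment> \<open>\<open>a\<close>, \<open>b\<close> and \<open>e\<close> bound additions,
    deletions and larger changes. \<open>a\<close> does not ask that the old slot be empty: this
    only enlarges it and makes it depend on the state through the superposition alone.
    \<open>b\<close> is a function of two states so that the swap applies to it.\<close>
  define a where "a = (\<lambda>p :: (nat \<Rightarrow> nat \<times> (nat \<Rightarrow> 'a)) \<times> (nat \<times> (nat \<Rightarrow> 'a)). if fst (snd p) = 1 then (if add_point (superpose k (fst p)) (snd (snd p) 0) \<notin> C then 1 else 0) else 0 :: ennreal)"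
  define b where "b = (\<lambda>p :: (nat \<Rightarrow> nat \<times> (nat \<Rightarrow> 'a)) \<times> (nat \<Rightarrow> nat \<times> (nat \<Rightarrow> 'a)). if fst (fst p j) = 1 \<and> fst (snd p j) = 0 \<and> superpose k (fst p) \<in> C \<and> superpose k (snd p) \<notin> C then 1 else 0 :: ennreal)"
  define e where "e = (\<lambda>p :: (nat \<Rightarrow> nat \<times> (nat \<Rightarrow> 'a)) \<times> (nat \<times> (nat \<Rightarrow> 'a)). of_nat ((fst (fst p j) + fst (snd p)) * (fst (fst p j) + fst (snd p) - 1)) :: ennreal)"
  have ma: "a \<in> borel_measurable (Q \<Otimes>\<^sub>M S)" unfolding a_def by measurable
  have mb[measurable]: "b \<in> borel_measurable (Q \<Otimes>\<^sub>M Q)" unfolding b_def by measurable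
  have mb': "(\<lambda>p. b (fst p, (fst p)(j := snd p))) \<in> borel_measurable (Q \<Otimes>\<^sub>M S)" by measurable
  have me: "e \<in> borel_measurable (Q \<Otimes>\<^sub>M S)" unfolding e_def by measurable
  have mS: "(\<lambda>s. f (y, s)) \<in> borel_measurable S" if "y \<in> space Q" "f \<in> borel_measurable (Q \<Otimes>\<^sub>M S)"
    for f :: "_ \<Rightarrow> ennreal" and y
    using that(2,1) by (rule measurable_Pair2)
  have mI: "(\<lambda>y. \<integral>\<^sup>+s. f (y, s) \<partial>S) \<in> borel_measurable Q" if "f \<in> borel_measurable (Q \<Otimes>\<^sub>M S)" for f
    using S.borel_measurable_nn_integral_fst[OF that] .
  have mIC: "(\<lambda>y. \<integral>\<^sup>+s. f (y, s) \<partial>S) \<in> borel_measurable QC" if "f \<in> borel_measurable (Q \<Otimes>\<^sub>M S)" for f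
    using mI[OF that] by (simp cong: measurable_cong_sets add: sets_QC)
  have AE_G: "AE y in QC. y \<in> G"
    unfolding QC_def using G_pos by (intro AE_uniform_measureI) auto
  have point: "of_nat (rejection_cost C k j y s) \<le> a (y, s) + (b (y, y(j := s)) + e (y, s))" if "y \<in> G" for y s
  proof -
    consider "fst (y j) = 0" "fst s = 0" | "fst (y j) = 0" "fst s = 1" | "fst (y j) = 1" "fst s = 0" | "fst (y j) + fst s \<ge> 2"
      by linarith
    then show ?thesis
    proof cases
      case 1
      then show ?thesis by (simp add: rejection_cost_def)
    next
      case 2
      then show ?thesis
        using superpose_add_point[OF j, of y s] by (simp add: rejection_cost_def a_def)
    next
      \<comment> \<open>Here the hypothesis that the old state lies in \<open>G\<close> enters: a
        rejected deletion leads from \<open>C\<close> to its complement.\<close>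
      case 3
      then show ?thesis
        using that by (simp add: rejection_cost_def b_def G_def)
    next
      case 4
      have "rejection_cost C k j y s \<le> (fst (y j) + fst s) * 1" by (simp add: rejection_cost_def)
      \<comment> \<open>The factor added is at least 1 as the total is at least 2.\<close>
      also have "\<dots> \<le> (fst (y j) + fst s) * (fst (y j) + fst s - 1)" using 4 by (intro mult_left_mono) auto
      finally have "of_nat (rejection_cost C k j y s) \<le> e (y, s)"
        unfolding e_def fst_conv snd_conv by (rule of_nat_mono)
      then show ?thesis
        by (meson add_increasing order_trans zero_le)
    qed
  qed
  have "(\<integral>\<^sup>+y. \<integral>\<^sup>+s. of_nat (rejection_cost C k j y s) \<partial>S \<partial>QC)
      \<le> (\<integral>\<^sup>+y. (\<integral>\<^sup>+s. a (y, s) \<partial>S) + ((\<integral>\<^sup>+s. b (y, y(j := s)) \<partial>S) + (\<integral>\<^sup>+s. e (y, s) \<partial>S)) \<partial>QC)"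
  proof (rule nn_integral_mono_AE, use AE_G in eventually_elim)
    case (elim y)
    then have y: "y \<in> space Q" by (simp add: G_def)
    have "(\<integral>\<^sup>+s. of_nat (rejection_cost C k j y s) \<partial>S) \<le> (\<integral>\<^sup>+s. a (y, s) + (b (y, y(j := s)) + e (y, s)) \<partial>S)"
      by (intro nn_integral_mono point elim)
    also have "\<dots> = (\<integral>\<^sup>+s. a (y, s) \<partial>S) + ((\<integral>\<^sup>+s. b (y, y(j := s)) \<partial>S) + (\<integral>\<^sup>+s. e (y, s) \<partial>S))"
      using mS[OF y ma] mS[OF y mb'] mS[OF y me] by (simp add: nn_integral_add)
    finally show ?case .
  qed
  also have "\<dots> = (\<integral>\<^sup>+y. \<integral>\<^sup>+s. a (y, s) \<partial>S \<partial>QC) + ((\<integral>\<^sup>+y. \<integral>\<^sup>+s. b (y, y(j := s)) \<partial>S \<partial>QC) + (\<integral>\<^sup>+y. \<integral>\<^sup>+s. e (y, s) \<partial>S \<partial>QC))"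
    using mIC[OF ma] mIC[OF mb'] mIC[OF me] by (simp add: nn_integral_add)
  finally have split: "(\<integral>\<^sup>+y. \<integral>\<^sup>+s. of_nat (rejection_cost C k j y s) \<partial>S \<partial>QC)
      \<le> (\<integral>\<^sup>+y. \<integral>\<^sup>+s. a (y, s) \<partial>S \<partial>QC) + ((\<integral>\<^sup>+y. \<integral>\<^sup>+s. b (y, y(j := s)) \<partial>S \<partial>QC) + (\<integral>\<^sup>+y. \<integral>\<^sup>+s. e (y, s) \<partial>S \<partial>QC))" .
  have A: "(\<integral>\<^sup>+y. \<integral>\<^sup>+s. a (y, s) \<partial>S \<partial>QC)
      \<le> ennreal \<mu> * (\<integral>\<^sup>+\<phi>. \<integral>\<^sup>+x. (if add_point \<phi> x \<notin> C then 1 else 0) \<partial>D \<partial>distr QC config_space (superpose k))"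
  proof -
    have m1: "(\<lambda>p. if add_point (fst p) (snd p) \<notin> C then 1 else 0 :: ennreal) \<in> borel_measurable (config_space \<Otimes>\<^sub>M D)"
      unfolding mD by measurable
    have m2: "(\<lambda>\<phi>. \<integral>\<^sup>+x. (if add_point \<phi> x \<notin> C then 1 else 0) \<partial>D) \<in> borel_measurable config_space"
      using D.borel_measurable_nn_integral_fst[OF m1] by simp
    have m3: "superpose k \<in> measurable QC config_space"
      using measurable_superpose by (simp cong: measurable_cong_sets add: sets_QC)
    have "(\<integral>\<^sup>+y. \<integral>\<^sup>+s. a (y, s) \<partial>S \<partial>QC)
        \<le> (\<integral>\<^sup>+y. ennreal \<mu> * (\<integral>\<^sup>+x. (if add_point (superpose k y) x \<notin> C then 1 else 0) \<partial>D) \<partial>QC)"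
    proof (rule nn_integral_mono)
      fix y :: "nat \<Rightarrow> nat \<times> (nat \<Rightarrow> 'a)"
      have "superpose k y \<in> space config_space"
        by (simp add: space_config_space superpose_in_configurations)
      from measurable_Pair2[OF m1 this]
      have "(\<lambda>x. if add_point (superpose k y) x \<notin> C then 1 else 0 :: ennreal) \<in> borel_measurable borel"
        using sets_D by (simp cong: measurable_cong_sets)
      from nn_integral_one_point_le[OF this]
      show "(\<integral>\<^sup>+s. a (y, s) \<partial>S) \<le> ennreal \<mu> * (\<integral>\<^sup>+x. (if add_point (superpose k y) x \<notin> C then 1 else 0) \<partial>D)"
        unfolding a_def fst_conv snd_conv .
    qed
    also have "\<dots> = ennreal \<mu> * (\<integral>\<^sup>+y. \<integral>\<^sup>+x. (if add_point (superpose k y) x \<notin> C then 1 else 0) \<partial>D \<partial>QC)"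
      by (rule nn_integral_cmult[OF measurable_compose[OF m3 m2]])
    also have "(\<integral>\<^sup>+y. \<integral>\<^sup>+x. (if add_point (superpose k y) x \<notin> C then 1 else 0) \<partial>D \<partial>QC)
        = (\<integral>\<^sup>+\<phi>. \<integral>\<^sup>+x. (if add_point \<phi> x \<notin> C then 1 else 0) \<partial>D \<partial>distr QC config_space (superpose k))"
      using m2 by (subst nn_integral_distr[OF m3]) auto
    finally show ?thesis .
  qed
  have B: "(\<integral>\<^sup>+y. \<integral>\<^sup>+s. b (y, y(j := s)) \<partial>S \<partial>QC) = 0"
  proof -
    have m1: "(\<lambda>p. if add_point (fst p) (snd p) \<in> C \<and> fst p \<notin> C then 1 else 0 :: ennreal) \<in> borel_measurable (config_space \<Otimes>\<^sub>M D)"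
      unfolding mD by measurable
    have m2: "(\<lambda>\<phi>. \<integral>\<^sup>+x. (if add_point \<phi> x \<in> C \<and> \<phi> \<notin> C then 1 else 0) \<partial>D) \<in> borel_measurable config_space"
      using D.borel_measurable_nn_integral_fst[OF m1] by simp
    \<comment> \<open>Exchanging the two states reverses time: \<open>y\<close> now has an empty
      slot and lies outside \<open>C\<close>, while adding the point of \<open>s\<close> leads into
      \<open>C\<close>.\<close>
    have "(\<integral>\<^sup>+y. \<integral>\<^sup>+s. b (y, y(j := s)) \<partial>S \<partial>Q) = (\<integral>\<^sup>+y. \<integral>\<^sup>+s. b (y(j := s), y) \<partial>S \<partial>Q)"
      by (rule nn_integral_update_slot_swap[OF j mb])
    also have "\<dots> \<le> (\<integral>\<^sup>+y. ennreal \<mu> * (\<integral>\<^sup>+x. (if add_point (superpose k y) x \<in> C \<and> superpose k y \<notin> C then 1 else 0) \<partial>D) \<partial>Q)"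
    proof (rule nn_integral_mono)
      fix y :: "nat \<Rightarrow> nat \<times> (nat \<Rightarrow> 'a)"
      have "superpose k y \<in> space config_space"
        by (simp add: space_config_space superpose_in_configurations)
      from measurable_Pair2[OF m1 this]
      have m: "(\<lambda>x. if add_point (superpose k y) x \<in> C \<and> superpose k y \<notin> C then 1 else 0 :: ennreal) \<in> borel_measurable borel"
        using sets_D by (simp cong: measurable_cong_sets)
      have "(\<integral>\<^sup>+s. b (y(j := s), y) \<partial>S)
          \<le> (\<integral>\<^sup>+s. (if fst s = 1 then (if add_point (superpose k y) (snd s 0) \<in> C \<and> superpose k y \<notin> C then 1 else 0) else 0) \<partial>S)"
        using superpose_add_point[OF j, of y] by (intro nn_integral_mono) (auto simp: b_def)
      also have "\<dots> \<le> ennreal \<mu> * (\<integral>\<^sup>+x. (if add_point (superpose k y) x \<in> C \<and> superpose k y \<notin> C then 1 else 0) \<partial>D)"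
        by (rule nn_integral_one_point_le[OF m])
      finally show "(\<integral>\<^sup>+s. b (y(j := s), y) \<partial>S)
          \<le> ennreal \<mu> * (\<integral>\<^sup>+x. (if add_point (superpose k y) x \<in> C \<and> superpose k y \<notin> C then 1 else 0) \<partial>D)" .
    qed
    also have "\<dots> = ennreal \<mu> * (\<integral>\<^sup>+y. \<integral>\<^sup>+x. (if add_point (superpose k y) x \<in> C \<and> superpose k y \<notin> C then 1 else 0) \<partial>D \<partial>Q)"
      by (rule nn_integral_cmult[OF measurable_compose[OF measurable_superpose m2]])
    also have "(\<integral>\<^sup>+y. \<integral>\<^sup>+x. (if add_point (superpose k y) x \<in> C \<and> superpose k y \<notin> C then 1 else 0) \<partial>D \<partial>Q)
        = (\<integral>\<^sup>+\<phi>. \<integral>\<^sup>+x. (if add_point \<phi> x \<in> C \<and> \<phi> \<notin> C then 1 else 0) \<partial>D \<partial>distr Q config_space (superpose k))"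
      using m2 by (subst nn_integral_distr[OF measurable_superpose]) auto
    also note null
    finally have z: "(\<integral>\<^sup>+y. \<integral>\<^sup>+s. b (y, y(j := s)) \<partial>S \<partial>Q) = 0" by (simp only: le_zero_eq)
    have "(\<integral>\<^sup>+y. \<integral>\<^sup>+s. b (y, y(j := s)) \<partial>S \<partial>QC) \<le> (\<integral>\<^sup>+y. \<integral>\<^sup>+s. b (y, y(j := s)) \<partial>S \<partial>Q) / emeasure Q G"
      using mI[OF mb'] by (intro nn_integral_QC_le) simp
    then show ?thesis unfolding z by simp
  qed
  have E: "(\<integral>\<^sup>+y. \<integral>\<^sup>+s. e (y, s) \<partial>S \<partial>QC) \<le> ennreal (4 * \<mu>\<^sup>2) / emeasure Q G"
  proof -
    have "(\<integral>\<^sup>+y. \<integral>\<^sup>+s. e (y, s) \<partial>S \<partial>QC) \<le> (\<integral>\<^sup>+y. \<integral>\<^sup>+s. e (y, s) \<partial>S \<partial>Q) / emeasure Q G"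
      using mI[OF me] by (rule nn_integral_QC_le)
    also have "(\<integral>\<^sup>+y. \<integral>\<^sup>+s. e (y, s) \<partial>S \<partial>Q) = ennreal (4 * \<mu>\<^sup>2)"
    proof -
      have [measurable]: "(\<lambda>p. fst (fst p)) \<in> measurable (S \<Otimes>\<^sub>M S) (count_space UNIV)"
        "(\<lambda>p. fst (snd p)) \<in> measurable (S \<Otimes>\<^sub>M S) (count_space UNIV)"
        by (rule measurable_compose[OF measurable_fst measurable_fst_S] measurable_compose[OF measurable_snd measurable_fst_S])+
      have "(\<lambda>(t, s). of_nat ((fst t + fst s) * (fst t + fst s - 1)) :: ennreal) \<in> borel_measurable (S \<Otimes>\<^sub>M S)"
        unfolding case_prod_beta' by measurable
      from nn_integral_slot_pair[OF j this] show ?thesis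
        unfolding nn_integral_two_slots by (simp add: e_def)
    qed
    finally show ?thesis .
  qed
  show ?thesis
    using split add_mono[OF A E] unfolding B add_0 by (rule order_trans)
qed

end

subsection \<open>The bound\<close>

text \<open>The zero measure cannot be normalised; there any probability measure serves, since the
  prefactor is 0.\<close>

lemma normalized_measure:
  fixes M :: "'a::topological_space measure"
  assumes "finite_measure M" and s: "sets M = sets borel"
  obtains D where "prob_space D" "sets D = sets borel"
    "\<And>f. f \<in> borel_measurable borel \<Longrightarrow>
      ennreal (measure M (space M)) * (\<integral>\<^sup>+x. f x \<partial>D) = (\<integral>\<^sup>+x. f x \<partial>M)"
proof (cases "emeasure M (space M) = 0")
  interpret finite_measure M by fact
  case True
  show thesis
  proof (rule that[of "return borel undefined"])
    show "prob_space (return borel (undefined :: 'a))" by (rule prob_space_return) simp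
    fix f :: "'a \<Rightarrow> ennreal"
    have "AE x in M. f x = 0"
      using True by (intro AE_I[of _ _ "space M"]) auto
    then have "(\<integral>\<^sup>+x. f x \<partial>M) = (\<integral>\<^sup>+x. 0 \<partial>M)" by (rule nn_integral_cong_AE)
    then show "ennreal (measure M (space M)) * (\<integral>\<^sup>+x. f x \<partial>return borel undefined) = (\<integral>\<^sup>+x. f x \<partial>M)"
      using True by (simp add: measure_def)
  qed simp
next
  interpret finite_measure M by fact
  case False
  show thesis
  proof (rule that[of "uniform_measure M (space M)"])
    show "prob_space (uniform_measure M (space M))"
      using False by (intro prob_space_uniform_measure) auto
    show "sets (uniform_measure M (space M)) = sets borel" using s by simp
    fix f :: "'a \<Rightarrow> ennreal" assume "f \<in> borel_measurable borel"
    then have f: "f \<in> borel_measurable M" using s by (simp cong: measurable_cong_sets)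
    have "(\<integral>\<^sup>+x. f x * indicator (space M) x \<partial>M) = (\<integral>\<^sup>+x. f x \<partial>M)"
      by (intro nn_integral_cong) simp
    then show "ennreal (measure M (space M)) * (\<integral>\<^sup>+x. f x \<partial>uniform_measure M (space M)) = (\<integral>\<^sup>+x. f x \<partial>M)"
      using f False
      by (simp add: nn_integral_uniform_measure emeasure_eq_measure[symmetric] ennreal_times_divide
          mult.commute[of "emeasure M (space M)"] mult_divide_eq_ennreal)
  qed
qed

theorem theorem5p4:
  fixes ell M :: "'a::metric_space measure"
    and m :: "'a \<Rightarrow> ennreal"
    and \<Omega> :: "'w measure" and \<Phi> :: "'w \<Rightarrow> 'a measure"
    and \<Omega>' :: "'v measure" and \<Psi> :: "nat \<Rightarrow> 'v \<Rightarrow> 'a measure"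
    and C :: "'a measure set" and \<Phi>\<^sub>C :: "'v \<Rightarrow> 'a measure"
  assumes "locally compact (UNIV :: 'a set)"
    and "radon_measure ell"
    and "m \<in> borel_measurable borel"
    and "M = density ell m"
    and "finite_measure M"
    and "poisson_process \<Omega> M \<Phi>"
    and "C \<in> sets config_space"
    and "measure \<Omega> {\<omega> \<in> space \<Omega>. \<Phi> \<omega> \<in> C} > 0"
    and "almost_hereditary \<Omega> M \<Phi> C"
    and "independent_copies \<Omega>' \<Psi> (law \<Omega> \<Phi>)"
    and "\<Phi>\<^sub>C = conditional_process C \<Psi>"
  shows "tv_star (law \<Omega>' \<Phi>\<^sub>C) (law \<Omega> \<Phi>)
    \<le> (\<integral>\<^sup>+ x. m x * emeasure \<Omega>' {\<omega> \<in> space \<Omega>'. add_point (\<Phi>\<^sub>C \<omega>) x \<notin> C} \<partial>ell)"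
proof -
  note C[measurable] = \<open>C \<in> sets config_space\<close>
  have \<Phi>[measurable]: "\<Phi> \<in> measurable \<Omega> config_space" and "prob_space \<Omega>"
    using \<open>poisson_process \<Omega> M \<Phi>\<close> by (simp_all add: poisson_process_def point_process_def)
  interpret \<Omega>: prob_space \<Omega> by fact
  interpret M: finite_measure M by fact
  have sM: "sets M = sets borel"
    using assms(2,4) by (simp add: radon_measure_def)
  have \<Psi>: "\<Psi> n \<in> measurable \<Omega>' config_space" for n
    using assms(10) by (simp add: independent_copies_def point_process_def)
  have \<Phi>C: "\<Phi>\<^sub>C \<in> measurable \<Omega>' config_space"
    unfolding assms(11) using \<Psi> C by (rule measurable_conditional_process)
  interpret \<Omega>': prob_space \<Omega>'
    using assms(10) by (simp add: independent_copies_def point_process_def)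
  define P where "P = law \<Omega> \<Phi>"
  define PC where "PC = law \<Omega>' \<Phi>\<^sub>C"
  have sP: "sets P = sets config_space" "sets PC = sets config_space"
    by (simp_all add: P_def PC_def)
  interpret P: prob_space P unfolding P_def by (rule \<Omega>.prob_space_distr) simp
  interpret PC: prob_space PC unfolding PC_def using \<Phi>C by (rule \<Omega>'.prob_space_distr)
  have PC_measure: "measure P C = measure \<Omega> {\<omega> \<in> space \<Omega>. \<Phi> \<omega> \<in> C}"
    unfolding P_def by (simp add: measure_distr vimage_def Int_def conj_commute)
  define p where "p = measure P C"
  have p: "0 < p" "emeasure P C = ennreal p"
    using assms(8) PC_measure by (simp_all add: p_def P.emeasure_eq_measure)
  have PC_eq: "PC = uniform_measure P C"
    unfolding PC_def P_def assms(11)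
    by (rule law_conditional_process[OF assms(10) C]) (use p in \<open>simp add: P_def[symmetric]\<close>)
  obtain D where D: "prob_space D" "sets D = sets borel"
    and D_int: "\<And>f. f \<in> borel_measurable borel \<Longrightarrow>
      ennreal (measure M (space M)) * (\<integral>\<^sup>+x. f x \<partial>D) = (\<integral>\<^sup>+x. f x \<partial>M)"
    using normalized_measure[OF \<open>finite_measure M\<close> sM] by blast
  interpret D: prob_space D by fact
  define L where "L = measure M (space M)"
  have L0: "0 \<le> L" by (simp add: L_def)
  have M_D: "measure M A = L * measure D A" if "A \<in> sets borel" for A
  proof -
    have "ennreal (measure M A) = ennreal L * ennreal (measure D A)"
      using D_int[of "indicator A"] that sM D(2)
      by (simp add: M.emeasure_eq_measure D.emeasure_eq_measure L_def)
    then show ?thesis using L0 by (simp add: ennreal_mult[symmetric])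
  qed
  \<comment> \<open>The cost of a step integrates the point inside, against \<open>D\<close>; the
    claimed bound integrates it outside, against \<open>M\<close>.\<close>
  have fubini: "ennreal L * (\<integral>\<^sup>+\<phi>. \<integral>\<^sup>+x. h (\<phi>, x) \<partial>D \<partial>R) = (\<integral>\<^sup>+x. \<integral>\<^sup>+\<phi>. h (\<phi>, x) \<partial>R \<partial>M)"
    and fubini_measurable: "(\<lambda>x. \<integral>\<^sup>+\<phi>. h (\<phi>, x) \<partial>R) \<in> borel_measurable borel"
    if R: "prob_space R" "sets R = sets config_space" and h: "h \<in> borel_measurable (config_space \<Otimes>\<^sub>M borel)"
    for R and h :: "'a measure \<times> 'a \<Rightarrow> ennreal"
  proof -
    interpret R: prob_space R by fact
    interpret RM: pair_sigma_finite R M by unfold_locales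
    have hM: "h \<in> borel_measurable (R \<Otimes>\<^sub>M M)" and hD: "h \<in> borel_measurable (R \<Otimes>\<^sub>M D)"
      and hB: "h \<in> borel_measurable (R \<Otimes>\<^sub>M borel)"
      using h measurable_cong_sets[OF sets_pair_measure_cong[OF R(2) sM] refl]
        measurable_cong_sets[OF sets_pair_measure_cong[OF R(2) D(2)] refl]
        measurable_cong_sets[OF sets_pair_measure_cong[OF R(2) refl] refl] by blast+
    have inner: "(\<integral>\<^sup>+x. h (\<phi>, x) \<partial>M) = ennreal L * (\<integral>\<^sup>+x. h (\<phi>, x) \<partial>D)" if "\<phi> \<in> space R" for \<phi>
      using D_int[OF measurable_Pair2[OF hB that]] by (simp add: L_def)
    have "ennreal L * (\<integral>\<^sup>+\<phi>. \<integral>\<^sup>+x. h (\<phi>, x) \<partial>D \<partial>R) = (\<integral>\<^sup>+\<phi>. ennreal L * (\<integral>\<^sup>+x. h (\<phi>, x) \<partial>D) \<partial>R)"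
      using D.borel_measurable_nn_integral_fst[OF hD] by (rule nn_integral_cmult[symmetric])
    also have "\<dots> = (\<integral>\<^sup>+\<phi>. \<integral>\<^sup>+x. h (\<phi>, x) \<partial>M \<partial>R)"
      by (intro nn_integral_cong) (simp add: inner)
    also have "\<dots> = (\<integral>\<^sup>+x. \<integral>\<^sup>+\<phi>. h (\<phi>, x) \<partial>R \<partial>M)"
      using hM by (rule RM.Fubini[symmetric])
    finally show "ennreal L * (\<integral>\<^sup>+\<phi>. \<integral>\<^sup>+x. h (\<phi>, x) \<partial>D \<partial>R) = (\<integral>\<^sup>+x. \<integral>\<^sup>+\<phi>. h (\<phi>, x) \<partial>R \<partial>M)" .
    have "(\<lambda>(x, \<phi>). h (\<phi>, x)) \<in> borel_measurable (borel \<Otimes>\<^sub>M R)"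
      using measurable_compose[OF measurable_pair_swap' hB] by (simp add: case_prod_beta')
    then show "(\<lambda>x. \<integral>\<^sup>+\<phi>. h (\<phi>, x) \<partial>R) \<in> borel_measurable borel"
      by (rule R.borel_measurable_nn_integral)
  qed
  note measurable_add_point[measurable]
  define I where "I = (\<integral>\<^sup>+\<phi>. \<integral>\<^sup>+x. (if add_point \<phi> x \<notin> C then 1 else 0) \<partial>D \<partial>PC)"
  define B where "B = (\<integral>\<^sup>+ x. m x * emeasure \<Omega>' {\<omega> \<in> space \<Omega>'. add_point (\<Phi>\<^sub>C \<omega>) x \<notin> C} \<partial>ell)"
  have I_B: "ennreal L * I = B"
  proof -
    let ?h = "\<lambda>q. if add_point (fst q) (snd q) \<notin> C then 1 else 0 :: ennreal"
    have h: "?h \<in> borel_measurable (config_space \<Otimes>\<^sub>M borel)" by measurable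
    have e: "(\<integral>\<^sup>+\<phi>. ?h (\<phi>, x) \<partial>PC) = emeasure \<Omega>' {\<omega> \<in> space \<Omega>'. add_point (\<Phi>\<^sub>C \<omega>) x \<notin> C}" for x
    proof -
      have hx: "(\<lambda>\<phi>. ?h (\<phi>, x)) \<in> borel_measurable config_space"
        by (rule measurable_Pair1[OF h]) simp
      have "(\<lambda>\<omega>. add_point (\<Phi>\<^sub>C \<omega>) x) \<in> measurable \<Omega>' config_space"
        using measurable_compose[OF measurable_Pair[OF \<Phi>C measurable_const] measurable_add_point, of x] by simp
      then have "{\<omega> \<in> space \<Omega>'. add_point (\<Phi>\<^sub>C \<omega>) x \<notin> C} \<in> sets \<Omega>'"
        by measurable
      then have "emeasure \<Omega>' {\<omega> \<in> space \<Omega>'. add_point (\<Phi>\<^sub>C \<omega>) x \<notin> C}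
          = (\<integral>\<^sup>+\<omega>. indicator {\<omega> \<in> space \<Omega>'. add_point (\<Phi>\<^sub>C \<omega>) x \<notin> C} \<omega> \<partial>\<Omega>')"
        by simp
      also have "\<dots> = (\<integral>\<^sup>+\<omega>. ?h (\<Phi>\<^sub>C \<omega>, x) \<partial>\<Omega>')"
        by (intro nn_integral_cong) auto
      also have "\<dots> = (\<integral>\<^sup>+\<phi>. ?h (\<phi>, x) \<partial>PC)"
        unfolding PC_def using hx by (subst nn_integral_distr[OF \<Phi>C]) auto
      finally show ?thesis by simp
    qed
    have mell: "measurable ell N = measurable borel N" for N :: "'c measure"
      using assms(2) by (intro measurable_cong_sets) (simp_all add: radon_measure_def)
    have "ennreal L * I = (\<integral>\<^sup>+x. \<integral>\<^sup>+\<phi>. ?h (\<phi>, x) \<partial>PC \<partial>M)"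
      using fubini[OF PC.prob_space_axioms sP(2) h] by (simp add: I_def)
    also have "\<dots> = (\<integral>\<^sup>+x. m x * (\<integral>\<^sup>+\<phi>. ?h (\<phi>, x) \<partial>PC) \<partial>ell)"
      unfolding assms(4)
      by (rule nn_integral_density) (simp_all only: mell assms(3) fubini_measurable[OF PC.prob_space_axioms sP(2) h])
    finally show ?thesis unfolding e B_def .
  qed
  \<comment> \<open>\<open>almost_hereditary\<close> fixes the point outside and the configuration
    inside; the exchange of integrals brings it into the form used for the cost of a step.\<close>
  have null: "ennreal L * (\<integral>\<^sup>+\<phi>. \<integral>\<^sup>+x. (if add_point \<phi> x \<in> C \<and> \<phi> \<notin> C then 1 else 0) \<partial>D \<partial>P) = 0"
  proof -
    let ?h = "\<lambda>q. if add_point (fst q) (snd q) \<in> C \<and> fst q \<notin> C then 1 else 0 :: ennreal"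
    have h: "?h \<in> borel_measurable (config_space \<Otimes>\<^sub>M borel)" by measurable
    have "AE x in M. (\<integral>\<^sup>+\<phi>. ?h (\<phi>, x) \<partial>P) = 0"
      using assms(9) unfolding almost_hereditary_def
    proof eventually_elim
      case (elim x)
      have hx: "(\<lambda>\<phi>. ?h (\<phi>, x)) \<in> borel_measurable config_space"
        by (rule measurable_Pair1[OF h]) simp
      have "(\<integral>\<^sup>+\<phi>. ?h (\<phi>, x) \<partial>P) = (\<integral>\<^sup>+\<omega>. ?h (\<Phi> \<omega>, x) \<partial>\<Omega>)"
        unfolding P_def using hx by (subst nn_integral_distr[OF \<Phi>]) auto
      also have "\<dots> = (\<integral>\<^sup>+\<omega>. 0 \<partial>\<Omega>)"
        using elim by (rule nn_integral_cong_AE[OF AE_mp]) simp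
      finally show ?case by simp
    qed
    then have "(\<integral>\<^sup>+x. \<integral>\<^sup>+\<phi>. ?h (\<phi>, x) \<partial>P \<partial>M) = (\<integral>\<^sup>+x. 0 \<partial>M)"
      by (rule nn_integral_cong_AE)
    then show ?thesis
      using fubini[OF P.prob_space_axioms sP(1) h] by simp
  qed
  \<comment> \<open>The \<open>k\<close> remainders \<open>4 * \<mu>\<^sup>2 / p\<close> with
    \<open>\<mu> = L / real k\<close> add up to the error term, while \<open>B\<close> arises as
    \<open>k * \<mu> * I = L * I\<close>.\<close>
  have bound: "tv_star PC P \<le> B + ennreal (4 * L\<^sup>2 / p / real k)" if k: "0 < k" for k
  proof -
    define \<mu> where "\<mu> = L / real k"
    have \<mu>0: "0 \<le> \<mu>" using L0 by (simp add: \<mu>_def)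
    have k\<mu>: "real k * \<mu> = L" using k by (simp add: \<mu>_def)
    interpret poisson_slots D \<mu> k
      using D \<mu>0 by unfold_locales
    have QP: "distr Q config_space (superpose k) = P"
      unfolding P_def by (rule law_superpose[OF assms(6)]) (simp add: k\<mu> M_D)
    have QG: "emeasure Q {y \<in> space Q. superpose k y \<in> C} = ennreal p"
      unfolding p(2)[symmetric] QP[symmetric]
      by (simp add: emeasure_distr vimage_def Int_def conj_commute)
    interpret conditioned_slots D \<mu> k C
      using QG p(1) by unfold_locales simp_all
    have QCP: "distr QC config_space (superpose k) = PC"
      unfolding distr_QC QP PC_eq ..
    have null': "ennreal \<mu> * (\<integral>\<^sup>+\<phi>. \<integral>\<^sup>+x. (if add_point \<phi> x \<in> C \<and> \<phi> \<notin> C then 1 else 0) \<partial>D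
        \<partial>distr Q config_space (superpose k)) = 0"
      \<comment> \<open>Either the integral is 0 or \<open>L\<close> is, and in the latter case
        \<open>\<mu>\<close> is 0 too.\<close>
      using null unfolding QP by (auto simp: \<mu>_def ennreal_eq_0_iff divide_le_0_iff)
    have "tv_star PC P \<le> (\<Sum>j<k. \<integral>\<^sup>+y. \<integral>\<^sup>+s. of_nat (rejection_cost C k j y s) \<partial>S \<partial>QC)"
      using tv_star_le_rejection_cost unfolding QP QCP .
    also have "\<dots> \<le> (\<Sum>j<k. ennreal \<mu> * I + ennreal (4 * \<mu>\<^sup>2) / ennreal p)"
      using rejection_cost_le[OF _ null'] unfolding QCP I_def G_def QG by (intro sum_mono) auto
    also have "\<dots> = of_nat k * (ennreal \<mu> * I) + of_nat k * (ennreal (4 * \<mu>\<^sup>2) / ennreal p)"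
      by (simp add: distrib_left)
    also have "of_nat k * (ennreal \<mu> * I) = B"
      using \<mu>0 by (simp add: I_B[symmetric] k\<mu>[symmetric] ennreal_mult ennreal_of_nat_eq_real_of_nat mult.assoc)
    also have "of_nat k * (ennreal (4 * \<mu>\<^sup>2) / ennreal p) = ennreal (real k * (4 * \<mu>\<^sup>2 / p))"
    proof -
      have "ennreal (4 * \<mu>\<^sup>2) / ennreal p = ennreal (4 * \<mu>\<^sup>2 / p)"
        using p(1) by (intro divide_ennreal) simp_all
      then show ?thesis
        unfolding ennreal_of_nat_eq_real_of_nat using p(1) by (simp only:) (intro ennreal_mult[symmetric], simp_all)
    qed
    also have "real k * (4 * \<mu>\<^sup>2 / p) = 4 * L\<^sup>2 / p / real k"
      using k by (simp add: \<mu>_def power2_eq_square field_simps)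
    finally show ?thesis .
  qed
  have "tv_star PC P \<le> B"
  proof (rule ennreal_le_epsilon)
    fix e :: real assume e: "0 < e"
    obtain k :: nat where k: "4 * L\<^sup>2 / p / e < real k" using reals_Archimedean2 by blast
    have "0 \<le> 4 * L\<^sup>2 / p / e" using p(1) e by simp
    then have k0: "0 < k" using k by (simp add: le_less_trans)
    have "4 * L\<^sup>2 / p / real k \<le> e"
      using k k0 e p(1) by (simp add: field_simps)
    then show "tv_star PC P \<le> B + ennreal e"
      using bound[OF k0] by (meson add_left_mono ennreal_leI order_trans)
  qed
  then show ?thesis by (simp add: PC_def P_def B_def)
qed

end
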